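(* Let $\mathsf{T}\colon \mathcal{S}\rightarrow \mathcal{S}^*$ be a continuous linear operator. Suppose that there are constants $C\geq 0$ and $p\geq 0$ such that its 2D-Fock transform satisfies $$|\widehat{\mathsf{T}}(\sigma,\tau)|\leq C\lambda_{\sigma}^p\lambda_{\tau}^p\quad\text{for all } \sigma,\tau\in\Gamma.$$ Then, for every $q> p+\frac{1}{2}$, there exists a unique $\widetilde{\mathsf{T}} \in \mathfrak{L}(\mathcal{S}_q,\mathcal{S}_q^* )$ such that $$\big\|\widetilde{\mathsf{T}}\big\|_{\mathfrak{L}(\mathcal{S}_q,\mathcal{S}_q^* )}\leq C\sum_{\sigma\in \Gamma}\lambda_{\sigma}^{-2(q-p)}$$ and $\widetilde{\mathsf{T}}\xi =\mathsf{T}\xi$ for all $\xi\in \mathcal{S}$.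
   Context: $\mathbb{N}=\{0,1,2,\dots\}$ and $\Gamma$ is the set of all finite subsets of $\mathbb{N}$. Bernoulli space: $\Sigma=\{-1,1\}^{\mathbb{N}}$, $\zeta_n(\omega)=\omega(n)$ for $\omega\in\Sigma$, $\mathscr{A}$ is the $\sigma$-field generated by $(\zeta_n)_{n\ge 0}$, $(\theta_n)_{n\ge0}$ is a given sequence with $0<\theta_n<1$, and $\mu$ is the unique probability measure on $\mathscr{A}$ under which the $\zeta_n$ are independent with $\mu(\zeta_n=1)=\theta_n$, $\mu(\zeta_n=-1)=1-\theta_n$. Put $Z_n=\frac{\zeta_n+1-2\theta_n}{2\sqrt{\theta_n(1-\theta_n)}}$, $Z_\emptyset=1$ and $Z_\sigma=\prod_{i\in\sigma}Z_i$ for nonempty $\sigma\in\Gamma$. $\mathcal{L}^2=\mathcal{L}^2(\Sigma,\mathscr{A},\mu)$ is the complex Hilbert space with inner product $\langle\xi,\eta\rangle=\int_\Sigma\overline{\xi}\eta\,d\mu$; $\{Z_\sigma\mid\sigma\in\Gamma\}$ is an orthonormal basis of $\mathcal{L}^2$. Define $\lambda_\emptyset=1$ and $\lambda_\sigma=\prod_{k\in\sigma}(1+k)$ for nonempty $\sigma\in\Gamma$ (the series $\sum_{\sigma\in\Gamma}\lambda_\sigma^{-r}$ converges for every real $r>1$). For real $p\ge0$, $\mathcal{S}_p=\{\xi\in\mathcal{L}^2\mid \sum_{\sigma\in\Gamma}\lambda_\sigma^{2p}|\langle Z_\sigma,\xi\rangle|^2<\infty\}$, a Hilbert space with norm $\|\xi\|_p=\big(\sum_{\sigma\in\Gamma}\lambda_\sigma^{2p}|\langle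 Z_\sigma,\xi\rangle|^2\big)^{1/2}$. $\mathcal{S}=\bigcap_{p\ge0}\mathcal{S}_p$ carries the topology generated by the norms $\|\cdot\|_p$, $p\ge0$ (each $Z_\sigma\in\mathcal{S}$, and $\mathcal{S}$ is dense in each $\mathcal{S}_p$). $\mathcal{S}_p^*$ is the dual of $\mathcal{S}_p$ (continuous linear functionals) with dual norm $\|\cdot\|_{-p}$, and $\mathcal{S}^*$ is the dual of $\mathcal{S}$ with the strong topology; by restriction of functionals to $\mathcal{S}$, $\mathcal{S}^*=\bigcup_{p\ge0}\mathcal{S}_p^*$. The bilinear pairing on $\mathcal{S}^*\times\mathcal{S}$ is $\langle\!\langle\Phi,\xi\rangle\!\rangle=\Phi(\xi)$. The 2D-Fock transform of an operator $\mathsf{T}\colon\mathcal{S}\to\mathcal{S}^*$ is the function $\widehat{\mathsf{T}}(\sigma,\tau)=\langle\!\langle\mathsf{T}Z_\sigma,Z_\tau\rangle\!\rangle$ on $\Gamma\times\Gamma$. $\mathfrak{L}(\mathcal{S}_q,\mathcal{S}_q^* )$ is the Banach space of bounded linear operators from $\mathcal{S}_q$ to $\mathcal{S}_q^*$ with the operator norm $\|\mathsf{T}\|_{\mathfrak{L}(\mathcal{S}_q,\mathcal{S}_q^* )}=\sup\{\|\mathsf{T}\xi\|_{-q}\mid\xi\in\mathcal{S}_q,\ \|\xi\|_q=1\}$. *)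

theory Defs
  imports "HOL-Probability.Probability"
begin

section \<open>Bernoulli space\<close>

text \<open>
  The space of \<open>bernoulli_space \<theta>\<close> is the set of all functions from the naturals into
  \<open>{-1, 1}\<close>, the product sigma-algebra on it is the one generated by the coordinate
  functions \<open>\<zeta>\<^sub>n \<omega> = \<omega> n\<close>.
\<close>

definition bernoulli_space :: "(nat \<Rightarrow> real) \<Rightarrow> (nat \<Rightarrow> real) measure" where
  "bernoulli_space \<theta> =
     (\<Pi>\<^sub>M n\<in>UNIV. point_measure {-1, 1} (\<lambda>x. ennreal (if x = 1 then \<theta> n else 1 - \<theta> n)))"

abbreviation finsets :: "nat set set" where
  "finsets \<equiv> {\<sigma>. finite \<sigma>}"


section \<open>The space of square integrable functions\<close>

text \<open>
  Elements are genuine classes of square integrable complex functions modulo almost everywhere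
  equality. Since the null sets depend on \<open>\<theta>\<close>, the space is a carrier set and not a type.
\<close>

type_synonym l2 = "((nat \<Rightarrow> real) \<Rightarrow> complex) set"

definition sq_integrable :: "(nat \<Rightarrow> real) \<Rightarrow> ((nat \<Rightarrow> real) \<Rightarrow> complex) set" where
  "sq_integrable \<theta> = {f \<in> borel_measurable (bernoulli_space \<theta>).
     integrable (bernoulli_space \<theta>) (\<lambda>\<omega>. (cmod (f \<omega>))\<^sup>2)}"

definition ae_rel ::
  "(nat \<Rightarrow> real) \<Rightarrow> (((nat \<Rightarrow> real) \<Rightarrow> complex) \<times> ((nat \<Rightarrow> real) \<Rightarrow> complex)) set" where
  "ae_rel \<theta> = {(f, g). f \<in> sq_integrable \<theta> \<and> g \<in> sq_integrable \<theta> \<and>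
     (AE \<omega> in bernoulli_space \<theta>. f \<omega> = g \<omega>)}"

definition L2 :: "(nat \<Rightarrow> real) \<Rightarrow> l2 set" where
  "L2 \<theta> = sq_integrable \<theta> // ae_rel \<theta>"

definition l2_class :: "(nat \<Rightarrow> real) \<Rightarrow> ((nat \<Rightarrow> real) \<Rightarrow> complex) \<Rightarrow> l2" where
  "l2_class \<theta> f = ae_rel \<theta> `` {f}"

definition l2_rep :: "l2 \<Rightarrow> (nat \<Rightarrow> real) \<Rightarrow> complex" where
  "l2_rep \<xi> = (SOME f. f \<in> \<xi>)"

text \<open>The linear combination \<open>a \<xi> + b \<eta>\<close>.\<close>

definition l2_lincomb :: "(nat \<Rightarrow> real) \<Rightarrow> complex \<Rightarrow> l2 \<Rightarrow> complex \<Rightarrow> l2 \<Rightarrow> l2" where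
  "l2_lincomb \<theta> a \<xi> b \<eta> = l2_class \<theta> (\<lambda>\<omega>. a * l2_rep \<xi> \<omega> + b * l2_rep \<eta> \<omega>)"

definition l2_diff :: "(nat \<Rightarrow> real) \<Rightarrow> l2 \<Rightarrow> l2 \<Rightarrow> l2" where
  "l2_diff \<theta> \<xi> \<eta> = l2_lincomb \<theta> 1 \<xi> (-1) \<eta>"

definition l2_inner :: "(nat \<Rightarrow> real) \<Rightarrow> l2 \<Rightarrow> l2 \<Rightarrow> complex" where
  "l2_inner \<theta> \<xi> \<eta> = (LINT \<omega>|bernoulli_space \<theta>. cnj (l2_rep \<xi> \<omega>) * l2_rep \<eta> \<omega>)"

definition Z1 :: "(nat \<Rightarrow> real) \<Rightarrow> nat \<Rightarrow> (nat \<Rightarrow> real) \<Rightarrow> real" where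
  "Z1 \<theta> n \<omega> = (\<omega> n + 1 - 2 * \<theta> n) / (2 * sqrt (\<theta> n * (1 - \<theta> n)))"

definition Z :: "(nat \<Rightarrow> real) \<Rightarrow> nat set \<Rightarrow> l2" where
  "Z \<theta> \<sigma> = l2_class \<theta> (\<lambda>\<omega>. complex_of_real (\<Prod>i\<in>\<sigma>. Z1 \<theta> i \<omega>))"


section \<open>Topologies generated by seminorms\<close>

text \<open>
  The topology on the carrier \<open>V\<close> which has as a subbase the balls of all the seminorms in \<open>Q\<close>;
  \<open>diff\<close> is the subtraction of the vector space \<open>V\<close>.
\<close>

definition seminorm_topology :: "'v set \<Rightarrow> ('v \<Rightarrow> 'v \<Rightarrow> 'v) \<Rightarrow> ('v \<Rightarrow> real) set \<Rightarrow> 'v topology" where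
  "seminorm_topology V diff Q =
     topology_generated_by {{y \<in> V. q (diff y x) < \<epsilon>} | q x \<epsilon>. q \<in> Q \<and> x \<in> V \<and> \<epsilon> > 0}"


section \<open>Testing functionals\<close>

definition lam :: "nat set \<Rightarrow> real" where
  "lam \<sigma> = (\<Prod>k\<in>\<sigma>. 1 + real k)"

definition Sp :: "(nat \<Rightarrow> real) \<Rightarrow> real \<Rightarrow> l2 set" where
  "Sp \<theta> p = {\<xi> \<in> L2 \<theta>.
     (\<lambda>\<sigma>. lam \<sigma> powr (2 * p) * (cmod (l2_inner \<theta> (Z \<theta> \<sigma>) \<xi>))\<^sup>2) summable_on finsets}"

definition Sp_norm :: "(nat \<Rightarrow> real) \<Rightarrow> real \<Rightarrow> l2 \<Rightarrow> real" where
  "Sp_norm \<theta> p \<xi> =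
     sqrt (\<Sum>\<^sub>\<infinity>\<sigma>\<in>finsets. lam \<sigma> powr (2 * p) * (cmod (l2_inner \<theta> (Z \<theta> \<sigma>) \<xi>))\<^sup>2)"

definition Sp_topology :: "(nat \<Rightarrow> real) \<Rightarrow> real \<Rightarrow> l2 topology" where
  "Sp_topology \<theta> p = seminorm_topology (Sp \<theta> p) (l2_diff \<theta>) {Sp_norm \<theta> p}"

definition S :: "(nat \<Rightarrow> real) \<Rightarrow> l2 set" where
  "S \<theta> = (\<Inter>p\<in>{0..}. Sp \<theta> p)"

definition S_topology :: "(nat \<Rightarrow> real) \<Rightarrow> l2 topology" where
  "S_topology \<theta> = seminorm_topology (S \<theta>) (l2_diff \<theta>) {Sp_norm \<theta> p | p. p \<ge> 0}"


section \<open>Dual spaces\<close>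

text \<open>
  Functionals on a carrier \<open>V\<close> are functions that are extensional on \<open>V\<close>, so that equality of
  functionals is equality of functions.
\<close>

definition dual :: "(nat \<Rightarrow> real) \<Rightarrow> l2 set \<Rightarrow> l2 topology \<Rightarrow> (l2 \<Rightarrow> complex) set" where
  "dual \<theta> V X = {\<Phi> \<in> extensional V.
     (\<forall>\<xi>\<in>V. \<forall>\<eta>\<in>V. \<forall>a b. \<Phi> (l2_lincomb \<theta> a \<xi> b \<eta>) = a * \<Phi> \<xi> + b * \<Phi> \<eta>) \<and>
     continuous_map X euclidean \<Phi>}"

definition Sp_dual :: "(nat \<Rightarrow> real) \<Rightarrow> real \<Rightarrow> (l2 \<Rightarrow> complex) set" where
  "Sp_dual \<theta> p = dual \<theta> (Sp \<theta> p) (Sp_topology \<theta> p)"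

definition Sp_dual_norm :: "(nat \<Rightarrow> real) \<Rightarrow> real \<Rightarrow> (l2 \<Rightarrow> complex) \<Rightarrow> real" where
  "Sp_dual_norm \<theta> p \<Phi> = Sup {cmod (\<Phi> \<xi>) | \<xi>. \<xi> \<in> Sp \<theta> p \<and> Sp_norm \<theta> p \<xi> \<le> 1}"

definition S_dual :: "(nat \<Rightarrow> real) \<Rightarrow> (l2 \<Rightarrow> complex) set" where
  "S_dual \<theta> = dual \<theta> (S \<theta>) (S_topology \<theta>)"

definition S_bounded :: "(nat \<Rightarrow> real) \<Rightarrow> l2 set \<Rightarrow> bool" where
  "S_bounded \<theta> B \<longleftrightarrow> B \<subseteq> S \<theta> \<and> (\<forall>p\<ge>0. bdd_above (Sp_norm \<theta> p ` B))"

text \<open>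
  The strong topology is uniform convergence on bounded sets. The empty set is left out because
  \<open>Sup {}\<close> is unspecified on the reals.
\<close>

definition S_dual_topology :: "(nat \<Rightarrow> real) \<Rightarrow> (l2 \<Rightarrow> complex) topology" where
  "S_dual_topology \<theta> =
     seminorm_topology (S_dual \<theta>) (\<lambda>\<Phi> \<Psi>. \<lambda>\<xi>\<in>S \<theta>. \<Phi> \<xi> - \<Psi> \<xi>)
       {\<lambda>\<Phi>. SUP \<xi>\<in>B. cmod (\<Phi> \<xi>) | B. S_bounded \<theta> B \<and> B \<noteq> {}}"


section \<open>Operators\<close>

text \<open>Linearity of a map \<open>T\<close> from \<open>V\<close> into functionals on \<open>V\<close>.\<close>

definition linear_op :: "(nat \<Rightarrow> real) \<Rightarrow> l2 set \<Rightarrow> (l2 \<Rightarrow> l2 \<Rightarrow> complex) \<Rightarrow> bool" where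
  "linear_op \<theta> V T \<longleftrightarrow> (\<forall>\<xi>\<in>V. \<forall>\<eta>\<in>V. \<forall>a b.
     \<forall>\<zeta>\<in>V. T (l2_lincomb \<theta> a \<xi> b \<eta>) \<zeta> = a * T \<xi> \<zeta> + b * T \<eta> \<zeta>)"

definition continuous_linear_S_op :: "(nat \<Rightarrow> real) \<Rightarrow> (l2 \<Rightarrow> l2 \<Rightarrow> complex) \<Rightarrow> bool" where
  "continuous_linear_S_op \<theta> T \<longleftrightarrow>
     T \<in> S \<theta> \<rightarrow> S_dual \<theta> \<and> linear_op \<theta> (S \<theta>) T \<and>
     continuous_map (S_topology \<theta>) (S_dual_topology \<theta>) T"

definition fock_transform ::
  "(nat \<Rightarrow> real) \<Rightarrow> (l2 \<Rightarrow> l2 \<Rightarrow> complex) \<Rightarrow> nat set \<Rightarrow> nat set \<Rightarrow> complex" where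
  "fock_transform \<theta> T \<sigma> \<tau> = T (Z \<theta> \<sigma>) (Z \<theta> \<tau>)"

definition bounded_Sp_ops :: "(nat \<Rightarrow> real) \<Rightarrow> real \<Rightarrow> (l2 \<Rightarrow> l2 \<Rightarrow> complex) set" where
  "bounded_Sp_ops \<theta> q = {T \<in> Sp \<theta> q \<rightarrow>\<^sub>E Sp_dual \<theta> q. linear_op \<theta> (Sp \<theta> q) T \<and>
     (\<exists>K. \<forall>\<xi>\<in>Sp \<theta> q. Sp_dual_norm \<theta> q (T \<xi>) \<le> K * Sp_norm \<theta> q \<xi>)}"

definition Sp_op_norm :: "(nat \<Rightarrow> real) \<Rightarrow> real \<Rightarrow> (l2 \<Rightarrow> l2 \<Rightarrow> complex) \<Rightarrow> real" where
  "Sp_op_norm \<theta> q T = Sup {Sp_dual_norm \<theta> q (T \<xi>) | \<xi>. \<xi> \<in> Sp \<theta> q \<and> Sp_norm \<theta> q \<xi> = 1}"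

end

theory Submission
  imports Defs
begin

text \<open>
  Only orthonormality of the \<open>Z\<^sub>\<sigma>\<close> is needed, not completeness: the norms of \<open>S\<^sub>p\<close> see an element
  \<open>\<xi>\<close> only through its coefficients \<open>\<langle>Z\<^sub>\<sigma>, \<xi>\<rangle>\<close>, so the partial sums \<open>\<Sum>\<^bsub>\<sigma>\<in>F\<^esub> \<langle>Z\<^sub>\<sigma>, \<xi>\<rangle> Z\<^sub>\<sigma>\<close> lie in
  \<open>S\<close> and converge to \<open>\<xi>\<close> in every norm that is finite on \<open>\<xi>\<close>. A continuous bilinear form is therefore
  determined by its values on pairs \<open>(Z\<^sub>\<sigma>, Z\<^sub>\<tau>)\<close>, which gives uniqueness. For existence put
  \<open>T' \<xi> \<eta> = \<Sum>\<^sub>\<sigma> \<langle>Z\<^sub>\<sigma>, \<xi>\<rangle> \<Sum>\<^sub>\<tau> \<langle>Z\<^sub>\<tau>, \<eta>\<rangle> k \<sigma> \<tau>\<close> with \<open>k\<close> the Fock transform. By Cauchy-Schwarz,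
  \<open>\<Sum>\<^sub>\<sigma> \<lambda>\<^sub>\<sigma>\<^sup>p |\<langle>Z\<^sub>\<sigma>, \<xi>\<rangle>| \<le> (\<Sum>\<^sub>\<sigma> \<lambda>\<^sub>\<sigma> powr (-2(q - p)))\<^bsup>1/2\<^esup> \<parallel>\<xi>\<parallel>\<^sub>q\<close>, and using this in both arguments bounds
  the form by \<open>C \<Sum>\<^sub>\<sigma> \<lambda>\<^sub>\<sigma> powr (-2(q - p)) \<parallel>\<xi>\<parallel>\<^sub>q \<parallel>\<eta>\<parallel>\<^sub>q\<close>.
\<close>

section \<open>Weighted square summable families\<close>

lemma lam_powr: "lam \<sigma> powr r = (\<Prod>k\<in>\<sigma>. (1 + real k) powr r)"
  by (simp add: lam_def prod_powr_distrib)

text \<open>Every finite family of finite sets lies in some \<open>Pow {..<n}\<close>, and the sum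
  over that power set is the expanded product of the factors 1 + (1 + k)^(-r) for k < n. Since 1 + x
  \<le> exp x, this product stays below the exponential of a convergent series, whatever
  \<open>n\<close> is.\<close>

lemma summable_lam:
  assumes r: "1 < r"
  shows "(\<lambda>\<sigma>. lam \<sigma> powr (-r)) summable_on finsets"
proof (rule nonneg_bdd_above_summable_on)
  let ?a = "\<lambda>k::nat. (1 + real k) powr (-r)"
  have "summable (\<lambda>k. real (Suc k) powr (-r))"
    using r by (subst summable_Suc_iff) (simp add: summable_real_powr_iff)
  then have a: "summable ?a" by (simp add: add.commute)
  show "bdd_above (sum (\<lambda>\<sigma>. lam \<sigma> powr (-r)) ` {F. F \<subseteq> finsets \<and> finite F})"
  proof (rule bdd_aboveI2)
    fix F assume F: "F \<in> {F. F \<subseteq> finsets \<and> finite F}"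
    then have "finite (\<Union>F)" by auto
    then obtain n where n: "\<Union>F \<subseteq> {..<n}"
      using finite_nat_iff_bounded by blast
    have "(\<Sum>\<sigma>\<in>F. lam \<sigma> powr (-r)) \<le> (\<Sum>\<sigma>\<in>Pow {..<n}. lam \<sigma> powr (-r))"
      using n by (intro sum_mono2) auto
    also have "\<dots> = (\<Prod>k<n. ?a k + 1)"
      by (subst prod_add) (simp_all add: lam_powr)
    also have "\<dots> \<le> (\<Prod>k<n. exp (?a k))"
      by (intro prod_mono) (simp add: add.commute)
    also have "\<dots> = exp (\<Sum>k<n. ?a k)"
      by (simp add: exp_sum)
    also have "\<dots> \<le> exp (suminf ?a)"
      using a by (simp add: sum_le_suminf)
    finally show "(\<Sum>\<sigma>\<in>F. lam \<sigma> powr (-r)) \<le> exp (suminf ?a)" .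
  qed
qed simp

lemma l2_set_le_infsum:
  fixes f :: "'a \<Rightarrow> real"
  assumes "(\<lambda>x. (f x)\<^sup>2) summable_on A" "finite F" "F \<subseteq> A"
  shows "L2_set f F \<le> sqrt (\<Sum>\<^sub>\<infinity>x\<in>A. (f x)\<^sup>2)"
  unfolding L2_set_def using assms by (intro real_sqrt_le_mono finite_sum_le_infsum) auto

text \<open>The finite triangle inequality for \<open>L2_set\<close> bounds all finite partial sums
  by one constant, which gives summability and Minkowski's inequality together. Pointwise domination
  as hypothesis lets the same lemma serve linear combinations and differences.\<close>

lemma
  fixes f g h :: "'a \<Rightarrow> real"
  assumes f: "(\<lambda>x. (f x)\<^sup>2) summable_on A" and g: "(\<lambda>x. (g x)\<^sup>2) summable_on A"
    and h: "\<And>x. x \<in> A \<Longrightarrow> \<bar>h x\<bar> \<le> \<bar>f x\<bar> + \<bar>g x\<bar>"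
  shows square_summable_triangle: "(\<lambda>x. (h x)\<^sup>2) summable_on A" (is ?sum)
    and minkowski_infsum: "sqrt (\<Sum>\<^sub>\<infinity>x\<in>A. (h x)\<^sup>2)
      \<le> sqrt (\<Sum>\<^sub>\<infinity>x\<in>A. (f x)\<^sup>2) + sqrt (\<Sum>\<^sub>\<infinity>x\<in>A. (g x)\<^sup>2)" (is "_ \<le> ?B")
proof -
  have le: "(\<Sum>x\<in>F. (h x)\<^sup>2) \<le> ?B\<^sup>2" if F: "finite F" "F \<subseteq> A" for F
  proof -
    have "L2_set h F = L2_set (\<lambda>x. \<bar>h x\<bar>) F" by (simp add: L2_set_def)
    also have "\<dots> \<le> L2_set (\<lambda>x. \<bar>f x\<bar> + \<bar>g x\<bar>) F"
      using h F by (intro L2_set_mono) auto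
    also have "\<dots> \<le> L2_set (\<lambda>x. \<bar>f x\<bar>) F + L2_set (\<lambda>x. \<bar>g x\<bar>) F"
      by (rule L2_set_triangle_ineq)
    also have "\<dots> = L2_set f F + L2_set g F" by (simp add: L2_set_def)
    also have "\<dots> \<le> ?B"
      using f g F by (intro add_mono l2_set_le_infsum)
    finally have "sqrt (\<Sum>x\<in>F. (h x)\<^sup>2) \<le> ?B" by (simp add: L2_set_def)
    then show ?thesis by (rule sqrt_le_D)
  qed
  show ?sum
    by (rule nonneg_bdd_above_summable_on) (auto intro!: bdd_aboveI2 le)
  then have "(\<Sum>\<^sub>\<infinity>x\<in>A. (h x)\<^sup>2) \<le> ?B\<^sup>2"
    by (rule infsum_le_finite_sums) (rule le)
  then show "sqrt (\<Sum>\<^sub>\<infinity>x\<in>A. (h x)\<^sup>2) \<le> ?B"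
    by (intro real_le_lsqrt add_nonneg_nonneg) (auto intro!: infsum_nonneg)
qed

text \<open>As for Minkowski, the finite Cauchy-Schwarz inequality bounds all partial sums
  uniformly, so absolute summability comes with the estimate.\<close>

lemma
  fixes f g :: "'a \<Rightarrow> real"
  assumes f: "(\<lambda>x. (f x)\<^sup>2) summable_on A" and g: "(\<lambda>x. (g x)\<^sup>2) summable_on A"
  shows cauchy_schwarz_summable: "(\<lambda>x. \<bar>f x * g x\<bar>) summable_on A" (is ?sum)
    and cauchy_schwarz_infsum: "(\<Sum>\<^sub>\<infinity>x\<in>A. \<bar>f x * g x\<bar>)
      \<le> sqrt (\<Sum>\<^sub>\<infinity>x\<in>A. (f x)\<^sup>2) * sqrt (\<Sum>\<^sub>\<infinity>x\<in>A. (g x)\<^sup>2)" (is "_ \<le> ?B")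
proof -
  have le: "(\<Sum>x\<in>F. \<bar>f x * g x\<bar>) \<le> ?B" if F: "finite F" "F \<subseteq> A" for F
  proof -
    have "(\<Sum>x\<in>F. \<bar>f x * g x\<bar>) \<le> L2_set f F * L2_set g F"
      unfolding abs_mult by (rule L2_set_mult_ineq)
    also have "\<dots> \<le> ?B"
      using f g F by (intro mult_mono l2_set_le_infsum) (auto intro: infsum_nonneg)
    finally show ?thesis .
  qed
  show ?sum
    by (rule nonneg_bdd_above_summable_on) (auto intro!: bdd_aboveI2 le)
  then show "(\<Sum>\<^sub>\<infinity>x\<in>A. \<bar>f x * g x\<bar>) \<le> ?B"
    by (rule infsum_le_finite_sums) (rule le)
qed


section \<open>Convergence in seminorm topologies\<close>

lemma openin_seminorm_ball:
  assumes "q \<in> Q" "x \<in> V" "0 < \<epsilon>"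
  shows "openin (seminorm_topology V diff Q) {y \<in> V. q (diff y x) < \<epsilon>}"
  unfolding seminorm_topology_def
  by (intro topology_generated_by_Basis CollectI exI conjI) (fact refl assms)+

text \<open>Induction on the generation of an open set: eventual membership passes through finite
  intersections and unions, which leaves the subbasic balls.\<close>

lemma limitin_seminorm_topology:
  assumes tri: "\<And>q x y. q \<in> Q \<Longrightarrow> x \<in> V \<Longrightarrow> y \<in> V \<Longrightarrow> q (diff y x) \<le> q (diff y l) + q (diff l x)"
    and zero: "\<And>q. q \<in> Q \<Longrightarrow> q (diff l l) = 0" and "Q \<noteq> {}" and l: "l \<in> V"
    and f: "eventually (\<lambda>i. f i \<in> V) F"
    and lim: "\<And>q. q \<in> Q \<Longrightarrow> ((\<lambda>i. q (diff (f i) l)) \<longlongrightarrow> 0) F"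
  shows "limitin (seminorm_topology V diff Q) f l F"
  unfolding limitin_def
proof (intro conjI allI impI)
  let ?B = "{{y \<in> V. q (diff y x) < \<epsilon>} | q x \<epsilon>. q \<in> Q \<and> x \<in> V \<and> \<epsilon> > 0}"
  \<comment> \<open>The topspace is only the union of the balls, so some seminorm has to be present
    to place \<open>l\<close> in it.\<close>
  obtain q where q: "q \<in> Q" using \<open>Q \<noteq> {}\<close> by auto
  then have "l \<in> {y \<in> V. q (diff y l) < 1}"
    using l zero[OF q] by simp
  then show "l \<in> topspace (seminorm_topology V diff Q)"
    using openin_subset[OF openin_seminorm_ball[OF q l zero_less_one]] by blast
  fix U assume U: "openin (seminorm_topology V diff Q) U \<and> l \<in> U"
  then have "generate_topology_on ?B U"
    by (simp add: seminorm_topology_def openin_topology_generated_by)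
  then have "l \<in> U \<longrightarrow> eventually (\<lambda>i. f i \<in> U) F"
  proof induction
    case (Int a b)
    then show ?case by (auto intro: eventually_conj)
  next
    case (UN K)
    show ?case
    proof
      assume "l \<in> \<Union>K"
      then obtain X where "X \<in> K" "l \<in> X" by auto
      with UN.IH have "eventually (\<lambda>i. f i \<in> X) F" by blast
      then show "eventually (\<lambda>i. f i \<in> \<Union>K) F"
        by eventually_elim (use \<open>X \<in> K\<close> in blast)
    qed
  next
    case (Basis s)
    then obtain q x \<epsilon> where s: "s = {y \<in> V. q (diff y x) < \<epsilon>}" and q: "q \<in> Q" and x: "x \<in> V"
      by auto
    show ?case
    proof
      assume "l \<in> s"
      \<comment> \<open>The ball is centred at \<open>x\<close>, not at \<open>l\<close>; the room
        it leaves around \<open>l\<close> becomes the tolerance for the convergence.\<close>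
      then have "0 < \<epsilon> - q (diff l x)" by (simp add: s)
      with lim[OF q] have "eventually (\<lambda>i. q (diff (f i) l) < \<epsilon> - q (diff l x)) F"
        by (rule order_tendstoD)
      then show "eventually (\<lambda>i. f i \<in> s) F"
        using f
      proof eventually_elim
        case (elim i)
        then show ?case using tri[OF q x, of "f i"] by (simp add: s)
      qed
    qed
  qed simp
  then show "eventually (\<lambda>i. f i \<in> U) F" using U by simp
qed


section \<open>Orthonormality of the products of the normalized coordinates\<close>

locale bernoulli =
  fixes \<theta> :: "nat \<Rightarrow> real"
  assumes theta_pos: "0 < \<theta> n" and theta_less_1: "\<theta> n < 1"
begin

definition coin :: "nat \<Rightarrow> real measure" where
  "coin n = point_measure {-1, 1} (\<lambda>x. ennreal (if x = 1 then \<theta> n else 1 - \<theta> n))"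

lemma bernoulli_space_eq: "bernoulli_space \<theta> = Pi\<^sub>M UNIV coin"
  by (simp add: bernoulli_space_def coin_def[abs_def])

lemma sets_coin [measurable_cong]: "sets (coin n) = sets (count_space {-1, 1})"
  by (simp add: coin_def sets_point_measure)

lemma space_coin: "space (coin n) = {-1, 1}"
  by (simp add: coin_def space_point_measure)

lemma prob_space_coin: "prob_space (coin n)"
proof
  have "ennreal (1 - \<theta> n) + ennreal (\<theta> n) = 1"
    using theta_pos[of n] theta_less_1[of n] by (subst ennreal_plus[symmetric]) auto
  then show "emeasure (coin n) (space (coin n)) = 1"
    unfolding space_coin unfolding coin_def
    by (subst emeasure_point_measure_finite) auto
qed

sublocale P: product_prob_space coin UNIV
  by (intro product_prob_space.intro product_sigma_finite.intro product_prob_space_axioms.intro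
      prob_space_coin prob_space_imp_sigma_finite)

lemma integral_coin:
  fixes f :: "real \<Rightarrow> real"
  shows "integral\<^sup>L (coin n) f = \<theta> n * f 1 + (1 - \<theta> n) * f (-1)"
  unfolding coin_def using theta_pos[of n] theta_less_1[of n]
  by (subst lebesgue_integral_point_measure_finite) simp_all

lemma integrable_coin:
  fixes f :: "real \<Rightarrow> real"
  shows "integrable (coin n) f"
  unfolding coin_def by (rule integrable_point_measure_finite) auto

text \<open>This is independence: a function of the coordinates in \<open>J\<close> factors through
  restriction to \<open>J\<close>, the image measure is the finite product of the coins, and there
  the integral of a product splits by Fubini.\<close>

lemma
  fixes f :: "nat \<Rightarrow> real \<Rightarrow> real"
  assumes J: "finite J"
  shows integrable_prod_coordinates:
      "integrable (bernoulli_space \<theta>) (\<lambda>\<omega>. \<Prod>i\<in>J. f i (\<omega> i))" (is ?int)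
    and integral_prod_coordinates:
      "(LINT \<omega>|bernoulli_space \<theta>. (\<Prod>i\<in>J. f i (\<omega> i)))
        = (\<Prod>i\<in>J. \<theta> i * f i 1 + (1 - \<theta> i) * f i (-1))" (is ?eq)
proof -
  have r: "(\<lambda>x. restrict x J) \<in> measurable (Pi\<^sub>M UNIV coin) (Pi\<^sub>M J coin)"
    by (rule measurable_restrict_subset) simp
  have int: "integrable (Pi\<^sub>M J coin) (\<lambda>\<omega>. \<Prod>i\<in>J. f i (\<omega> i))"
    using J by (rule P.product_integrable_prod) (rule integrable_coin)
  have d: "distr (Pi\<^sub>M UNIV coin) (Pi\<^sub>M J coin) (\<lambda>x. restrict x J) = Pi\<^sub>M J coin"
    using J by (rule P.distr_PiM_restrict_finite) simp
  show ?int
    using integrable_distr[OF r, of "\<lambda>\<omega>. \<Prod>i\<in>J. f i (\<omega> i)"] int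
    by (simp add: d bernoulli_space_eq)
  have "(LINT \<omega>|bernoulli_space \<theta>. (\<Prod>i\<in>J. f i (\<omega> i)))
      = (LINT \<omega>|Pi\<^sub>M J coin. (\<Prod>i\<in>J. f i (\<omega> i)))"
    using integral_distr[OF r borel_measurable_integrable[OF int]]
    by (simp add: d bernoulli_space_eq)
  also have "\<dots> = (\<Prod>i\<in>J. integral\<^sup>L (coin i) (f i))"
    using J by (rule P.product_integral_prod) (rule integrable_coin)
  finally show ?eq by (simp add: integral_coin)
qed

text \<open>A concrete member of the class \<open>Z \<theta> \<sigma>\<close>. Integrals are
  computed with it and then transferred to the representative picked by
  \<open>l2_rep\<close>.\<close>

definition zfun :: "nat set \<Rightarrow> (nat \<Rightarrow> real) \<Rightarrow> complex" where
  "zfun \<sigma> \<omega> = complex_of_real (\<Prod>i\<in>\<sigma>. Z1 \<theta> i \<omega>)"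

text \<open>\<open>Z1\<close> as a function of the single coordinate value, the form needed to treat
  its products as products of coordinate functions.\<close>

definition z :: "nat \<Rightarrow> real \<Rightarrow> real" where
  "z n x = (x + 1 - 2 * \<theta> n) / (2 * sqrt (\<theta> n * (1 - \<theta> n)))"

lemma Z1_eq: "Z1 \<theta> n \<omega> = z n (\<omega> n)"
  by (simp add: Z1_def z_def)

lemma z_mean: "\<theta> n * z n 1 + (1 - \<theta> n) * z n (-1) = 0"
proof -
  \<comment> \<open>The numerators cancel by themselves, so the square root may be replaced by an
    arbitrary \<open>s\<close>.\<close>
  have "\<theta> n * ((1 + 1 - 2 * \<theta> n) / s) + (1 - \<theta> n) * ((-1 + 1 - 2 * \<theta> n) / s) = 0" for s
    by (cases "s = 0") (simp_all add: field_simps)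
  then show ?thesis unfolding z_def .
qed

lemma z_variance: "\<theta> n * (z n 1)\<^sup>2 + (1 - \<theta> n) * (z n (-1))\<^sup>2 = 1"
proof -
  have s: "(2 * sqrt (\<theta> n * (1 - \<theta> n)))\<^sup>2 = 4 * (\<theta> n * (1 - \<theta> n))"
    using theta_pos[of n] theta_less_1[of n] by (simp add: power_mult_distrib less_imp_le)
  show ?thesis
    using theta_pos[of n] theta_less_1[of n] unfolding z_def power_divide s
    by (simp add: divide_simps) (simp add: power2_eq_square algebra_simps)
qed

text \<open>Padding both products with factors 1 brings them to the common index set, so that
  \<open>integral_prod_coordinates\<close> applies to one product.\<close>

lemma zfun_mult:
  assumes "finite \<sigma>" "finite \<tau>"
  shows "zfun \<sigma> \<omega> * zfun \<tau> \<omega> = complex_of_real (\<Prod>i\<in>\<sigma> \<union> \<tau>.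
    (if i \<in> \<sigma> then z i (\<omega> i) else 1) * (if i \<in> \<tau> then z i (\<omega> i) else 1))"
proof -
  have "(\<Prod>i\<in>\<sigma> \<union> \<tau>. if i \<in> \<sigma> then z i (\<omega> i) else 1) = (\<Prod>i\<in>\<sigma>. z i (\<omega> i))"
    "(\<Prod>i\<in>\<sigma> \<union> \<tau>. if i \<in> \<tau> then z i (\<omega> i) else 1) = (\<Prod>i\<in>\<tau>. z i (\<omega> i))"
    using assms by (auto intro!: prod.mono_neutral_cong_right)
  then show ?thesis
    by (simp add: zfun_def Z1_eq prod.distrib)
qed

lemma integrable_zfun_mult:
  assumes "finite \<sigma>" "finite \<tau>"
  shows "integrable (bernoulli_space \<theta>) (\<lambda>\<omega>. zfun \<sigma> \<omega> * zfun \<tau> \<omega>)"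
  unfolding zfun_mult[OF assms] using assms
  by (intro integrable_of_real
      integrable_prod_coordinates[of _ "\<lambda>i x. (if i \<in> \<sigma> then z i x else 1) * (if i \<in> \<tau> then z i x else 1)"]) auto

text \<open>An index in both sets contributes the variance 1, an index in exactly one of them the
  mean 0. If the sets differ, an index of the second kind exists and annihilates the
  product.\<close>

lemma integral_zfun_mult:
  assumes "finite \<sigma>" "finite \<tau>"
  shows "(LINT \<omega>|bernoulli_space \<theta>. zfun \<sigma> \<omega> * zfun \<tau> \<omega>) = (if \<sigma> = \<tau> then 1 else 0)"
proof -
  let ?f = "\<lambda>i x. (if i \<in> \<sigma> then z i x else 1) * (if i \<in> \<tau> then z i x else 1)"
  let ?e = "\<lambda>i. \<theta> i * ?f i 1 + (1 - \<theta> i) * ?f i (-1)"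
  have "(LINT \<omega>|bernoulli_space \<theta>. zfun \<sigma> \<omega> * zfun \<tau> \<omega>)
      = complex_of_real (\<Prod>i\<in>\<sigma> \<union> \<tau>. ?e i)"
    unfolding zfun_mult[OF assms] integral_complex_of_real
    using integral_prod_coordinates[of "\<sigma> \<union> \<tau>" ?f] assms by simp
  also have "(\<Prod>i\<in>\<sigma> \<union> \<tau>. ?e i) = (if \<sigma> = \<tau> then 1 else 0)"
  proof (cases "\<sigma> = \<tau>")
    case True
    then have "?e i = 1" if "i \<in> \<sigma> \<union> \<tau>" for i
      using that z_variance[of i] by (auto simp: power2_eq_square)
    then show ?thesis using True by simp
  next
    case False
    then obtain i where i: "i \<in> \<sigma> \<union> \<tau>" "i \<notin> \<sigma> \<inter> \<tau>" by auto
    then have "?e i = 0" using z_mean[of i] by auto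
    then have "(\<Prod>i\<in>\<sigma> \<union> \<tau>. ?e i) = 0"
      using i(1) assms by (intro prod_zero bexI[of _ i]) simp_all
    then show ?thesis using False by simp
  qed
  finally show ?thesis by simp
qed

lemma zfun_measurable [measurable]: "zfun \<sigma> \<in> borel_measurable (bernoulli_space \<theta>)"
proof -
  have "(\<lambda>\<omega>. z i (\<omega> i)) \<in> borel_measurable (Pi\<^sub>M UNIV coin)" for i
    by (rule measurable_compose[OF measurable_component_singleton[of i]])
      (auto simp: measurable_cong_sets[OF sets_coin refl])
  then show ?thesis
    unfolding zfun_def[abs_def] Z1_eq bernoulli_space_eq by measurable
qed

lemma zfun_sq_integrable:
  assumes "finite \<sigma>"
  shows "zfun \<sigma> \<in> sq_integrable \<theta>"
proof -
  have "(cmod (zfun \<sigma> \<omega>))\<^sup>2 = cmod (zfun \<sigma> \<omega> * zfun \<sigma> \<omega>)" for \<omega>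
    by (simp add: norm_mult power2_eq_square)
  then show ?thesis
    using integrable_norm[OF integrable_zfun_mult[OF assms assms]] by (simp add: sq_integrable_def)
qed

section \<open>Square integrable classes and their inner product\<close>

lemma equiv_ae_rel: "equiv (sq_integrable \<theta>) (ae_rel \<theta>)"
proof (rule equivI)
  show "ae_rel \<theta> \<subseteq> sq_integrable \<theta> \<times> sq_integrable \<theta>"
    by (auto simp: ae_rel_def)
  show "refl_on (sq_integrable \<theta>) (ae_rel \<theta>)"
    by (auto simp: refl_on_def ae_rel_def)
  show "sym (ae_rel \<theta>)"
    by (auto simp: sym_def ae_rel_def eq_commute)
  show "trans (ae_rel \<theta>)"
  proof (rule transI)
    fix f g h assume "(f, g) \<in> ae_rel \<theta>" and "(g, h) \<in> ae_rel \<theta>"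
    then have sq: "f \<in> sq_integrable \<theta>" "h \<in> sq_integrable \<theta>"
      and "AE \<omega> in bernoulli_space \<theta>. f \<omega> = g \<omega>" "AE \<omega> in bernoulli_space \<theta>. g \<omega> = h \<omega>"
      by (simp_all add: ae_rel_def)
    from this(3,4) have "AE \<omega> in bernoulli_space \<theta>. f \<omega> = h \<omega>"
      by eventually_elim simp
    with sq show "(f, h) \<in> ae_rel \<theta>" by (simp add: ae_rel_def)
  qed
qed

lemma l2_class_in_L2: "f \<in> sq_integrable \<theta> \<Longrightarrow> l2_class \<theta> f \<in> L2 \<theta>"
  by (simp add: L2_def l2_class_def quotientI)

lemma l2_rep_sq_integrable:
  assumes "\<xi> \<in> L2 \<theta>"
  shows "l2_rep \<xi> \<in> sq_integrable \<theta>"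
proof -
  have "\<xi> \<noteq> {}" "\<xi> \<subseteq> sq_integrable \<theta>"
    using in_quotient_imp_non_empty[OF equiv_ae_rel] in_quotient_imp_subset[OF equiv_ae_rel] assms
    by (simp_all add: L2_def)
  then show ?thesis
    unfolding l2_rep_def using some_in_eq[of \<xi>] by blast
qed

text \<open>The choice in \<open>l2_rep\<close> may return another member of the class, so the inner
  product computations below go through almost everywhere equality under the integral.\<close>

lemma l2_rep_class:
  assumes "f \<in> sq_integrable \<theta>"
  shows "AE \<omega> in bernoulli_space \<theta>. l2_rep (l2_class \<theta> f) \<omega> = f \<omega>"
proof -
  have "f \<in> l2_class \<theta> f"
    using equiv_class_self[OF equiv_ae_rel assms] by (simp add: l2_class_def)
  then have "l2_rep (l2_class \<theta> f) \<in> l2_class \<theta> f"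
    unfolding l2_rep_def by (rule someI[of "\<lambda>g. g \<in> l2_class \<theta> f"])
  then show ?thesis
    by (auto simp: l2_class_def ae_rel_def eq_commute)
qed

lemma borel_measurable_cnj [measurable]: "cnj \<in> borel_measurable borel"
  by (intro borel_measurable_continuous_onI continuous_on_cnj continuous_on_id)

text \<open>Dominated by |f|^2 + |g|^2, because x y \<le> x^2 + y^2 for nonnegative reals.\<close>

lemma integrable_cnj_mult:
  assumes f: "f \<in> sq_integrable \<theta>" and g: "g \<in> sq_integrable \<theta>"
  shows "integrable (bernoulli_space \<theta>) (\<lambda>\<omega>. cnj (f \<omega>) * g \<omega>)"
proof (rule Bochner_Integration.integrable_bound)
  show "integrable (bernoulli_space \<theta>) (\<lambda>\<omega>. (cmod (f \<omega>))\<^sup>2 + (cmod (g \<omega>))\<^sup>2)"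
    using f g by (auto simp: sq_integrable_def)
  have [measurable]: "f \<in> borel_measurable (bernoulli_space \<theta>)"
    "g \<in> borel_measurable (bernoulli_space \<theta>)"
    using f g by (auto simp: sq_integrable_def)
  show "(\<lambda>\<omega>. cnj (f \<omega>) * g \<omega>) \<in> borel_measurable (bernoulli_space \<theta>)"
    by measurable
  have "x * y \<le> x\<^sup>2 + y\<^sup>2" if "0 \<le> x" "0 \<le> y" for x y :: real
    using sum_squares_bound[of x y] mult_nonneg_nonneg[OF that] by linarith
  then show "AE \<omega> in bernoulli_space \<theta>. cmod (cnj (f \<omega>) * g \<omega>)
      \<le> norm ((cmod (f \<omega>))\<^sup>2 + (cmod (g \<omega>))\<^sup>2)"
    by (auto simp: norm_mult)
qed

lemma sq_integrable_lincomb: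
  assumes f: "f \<in> sq_integrable \<theta>" and g: "g \<in> sq_integrable \<theta>"
  shows "(\<lambda>\<omega>. a * f \<omega> + b * g \<omega>) \<in> sq_integrable \<theta>"
proof -
  have [measurable]: "f \<in> borel_measurable (bernoulli_space \<theta>)"
    "g \<in> borel_measurable (bernoulli_space \<theta>)"
    using f g by (auto simp: sq_integrable_def)
  have "integrable (bernoulli_space \<theta>) (\<lambda>\<omega>. (cmod (a * f \<omega> + b * g \<omega>))\<^sup>2)"
  proof (rule Bochner_Integration.integrable_bound)
    show "integrable (bernoulli_space \<theta>)
        (\<lambda>\<omega>. 2 * (cmod a)\<^sup>2 * (cmod (f \<omega>))\<^sup>2 + 2 * (cmod b)\<^sup>2 * (cmod (g \<omega>))\<^sup>2)"
      using f g by (auto simp: sq_integrable_def)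
    have "(cmod (a * u + b * v))\<^sup>2 \<le> 2 * (cmod a)\<^sup>2 * (cmod u)\<^sup>2 + 2 * (cmod b)\<^sup>2 * (cmod v)\<^sup>2"
      for u v
    proof -
      have "(cmod (a * u + b * v))\<^sup>2 \<le> (cmod a * cmod u + cmod b * cmod v)\<^sup>2"
        by (intro power_mono) (metis norm_mult norm_triangle_ineq, simp)
      then show ?thesis
        using sum_squares_bound[of "cmod a * cmod u" "cmod b * cmod v"]
        by (simp add: power2_sum power_mult_distrib)
    qed
    then show "AE \<omega> in bernoulli_space \<theta>. norm ((cmod (a * f \<omega> + b * g \<omega>))\<^sup>2)
        \<le> norm (2 * (cmod a)\<^sup>2 * (cmod (f \<omega>))\<^sup>2 + 2 * (cmod b)\<^sup>2 * (cmod (g \<omega>))\<^sup>2)"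
      by simp
  qed measurable
  then show ?thesis by (simp add: sq_integrable_def)
qed

lemma l2_lincomb_in_L2:
  "\<xi> \<in> L2 \<theta> \<Longrightarrow> \<eta> \<in> L2 \<theta> \<Longrightarrow> l2_lincomb \<theta> a \<xi> b \<eta> \<in> L2 \<theta>"
  unfolding l2_lincomb_def
  by (rule l2_class_in_L2, rule sq_integrable_lincomb) (rule l2_rep_sq_integrable, assumption)+

lemma l2_inner_lincomb:
  assumes "\<zeta> \<in> L2 \<theta>" "\<xi> \<in> L2 \<theta>" "\<eta> \<in> L2 \<theta>"
  shows "l2_inner \<theta> \<zeta> (l2_lincomb \<theta> a \<xi> b \<eta>) = a * l2_inner \<theta> \<zeta> \<xi> + b * l2_inner \<theta> \<zeta> \<eta>"
proof -
  note r = assms[THEN l2_rep_sq_integrable]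
  let ?h = "\<lambda>\<omega>. a * l2_rep \<xi> \<omega> + b * l2_rep \<eta> \<omega>"
  have h: "?h \<in> sq_integrable \<theta>" by (rule sq_integrable_lincomb) (rule r)+
  have l: "l2_rep (l2_lincomb \<theta> a \<xi> b \<eta>) \<in> sq_integrable \<theta>"
    by (rule l2_rep_sq_integrable, rule l2_lincomb_in_L2) (rule assms)+
  have "l2_inner \<theta> \<zeta> (l2_lincomb \<theta> a \<xi> b \<eta>) = (LINT \<omega>|bernoulli_space \<theta>. cnj (l2_rep \<zeta> \<omega>) * ?h \<omega>)"
    unfolding l2_inner_def
  proof (rule integral_cong_AE)
    show "AE \<omega> in bernoulli_space \<theta>. cnj (l2_rep \<zeta> \<omega>) * l2_rep (l2_lincomb \<theta> a \<xi> b \<eta>) \<omega>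
        = cnj (l2_rep \<zeta> \<omega>) * ?h \<omega>"
      using l2_rep_class[OF h] unfolding l2_lincomb_def by eventually_elim simp
  qed (use integrable_cnj_mult[OF r(1) l] integrable_cnj_mult[OF r(1) h]
      in \<open>simp_all add: borel_measurable_integrable\<close>)
  also have "\<dots> = (LINT \<omega>|bernoulli_space \<theta>.
      a * (cnj (l2_rep \<zeta> \<omega>) * l2_rep \<xi> \<omega>) + b * (cnj (l2_rep \<zeta> \<omega>) * l2_rep \<eta> \<omega>))"
    by (simp add: algebra_simps)
  also have "\<dots> = a * l2_inner \<theta> \<zeta> \<xi> + b * l2_inner \<theta> \<zeta> \<eta>"
    by (simp add: l2_inner_def integrable_cnj_mult r)
  finally show ?thesis .
qed

lemma Z_eq: "Z \<theta> \<sigma> = l2_class \<theta> (zfun \<sigma>)"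
  by (simp add: Z_def zfun_def[abs_def])

lemma Z_in_L2: "finite \<sigma> \<Longrightarrow> Z \<theta> \<sigma> \<in> L2 \<theta>"
  by (simp add: Z_eq l2_class_in_L2 zfun_sq_integrable)

lemma Z_orthonormal:
  assumes "finite \<sigma>" "finite \<tau>"
  shows "l2_inner \<theta> (Z \<theta> \<sigma>) (Z \<theta> \<tau>) = (if \<sigma> = \<tau> then 1 else 0)"
proof -
  note [simp] = assms[THEN Z_in_L2, THEN l2_rep_sq_integrable] assms[THEN zfun_sq_integrable]
  have "l2_inner \<theta> (Z \<theta> \<sigma>) (Z \<theta> \<tau>) = (LINT \<omega>|bernoulli_space \<theta>. cnj (zfun \<sigma> \<omega>) * zfun \<tau> \<omega>)"
    unfolding l2_inner_def
  proof (rule integral_cong_AE)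
    show "AE \<omega> in bernoulli_space \<theta>. cnj (l2_rep (Z \<theta> \<sigma>) \<omega>) * l2_rep (Z \<theta> \<tau>) \<omega>
        = cnj (zfun \<sigma> \<omega>) * zfun \<tau> \<omega>"
      using assms[THEN zfun_sq_integrable, THEN l2_rep_class] unfolding Z_eq
      by eventually_elim simp
  qed (simp_all add: borel_measurable_integrable integrable_cnj_mult)
  also have "\<dots> = (LINT \<omega>|bernoulli_space \<theta>. zfun \<sigma> \<omega> * zfun \<tau> \<omega>)"
    by (simp add: zfun_def)
  finally show ?thesis using integral_zfun_mult[OF assms] by simp
qed


section \<open>Coefficients and norms\<close>

abbreviation coeff :: "l2 \<Rightarrow> nat set \<Rightarrow> complex" where
  "coeff \<xi> \<sigma> \<equiv> l2_inner \<theta> (Z \<theta> \<sigma>) \<xi>"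

lemma coeff_lincomb:
  "\<lbrakk>\<xi> \<in> L2 \<theta>; \<eta> \<in> L2 \<theta>; finite \<sigma>\<rbrakk> \<Longrightarrow>
    coeff (l2_lincomb \<theta> a \<xi> b \<eta>) \<sigma> = a * coeff \<xi> \<sigma> + b * coeff \<eta> \<sigma>"
  by (simp add: l2_inner_lincomb Z_in_L2)

lemma coeff_diff:
  "\<lbrakk>\<xi> \<in> L2 \<theta>; \<eta> \<in> L2 \<theta>; finite \<sigma>\<rbrakk> \<Longrightarrow> coeff (l2_diff \<theta> \<xi> \<eta>) \<sigma> = coeff \<xi> \<sigma> - coeff \<eta> \<sigma>"
  by (simp add: l2_diff_def coeff_lincomb)

text \<open>The weight carries the exponent \<open>p\<close> instead of \<open>2 * p\<close>, so
  that \<open>Sp_norm\<close> is the plain l2 norm of a real family and Minkowski and Cauchy-Schwarz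
  apply directly.\<close>

definition wcoeff :: "real \<Rightarrow> l2 \<Rightarrow> nat set \<Rightarrow> real" where
  "wcoeff p \<xi> \<sigma> = lam \<sigma> powr p * cmod (coeff \<xi> \<sigma>)"

lemma wcoeff_square: "(wcoeff p \<xi> \<sigma>)\<^sup>2 = lam \<sigma> powr (2 * p) * (cmod (coeff \<xi> \<sigma>))\<^sup>2"
  by (simp add: wcoeff_def power_mult_distrib power2_eq_square flip: powr_add)

lemma Sp_iff: "\<xi> \<in> Sp \<theta> p \<longleftrightarrow> \<xi> \<in> L2 \<theta> \<and> (\<lambda>\<sigma>. (wcoeff p \<xi> \<sigma>)\<^sup>2) summable_on finsets"
  by (simp add: Sp_def wcoeff_square)

lemma Sp_norm_eq: "Sp_norm \<theta> p \<xi> = sqrt (\<Sum>\<^sub>\<infinity>\<sigma>\<in>finsets. (wcoeff p \<xi> \<sigma>)\<^sup>2)"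
  by (simp add: Sp_norm_def wcoeff_square)

lemma Sp_norm_nonneg: "0 \<le> Sp_norm \<theta> p \<xi>"
  by (simp add: Sp_norm_eq infsum_nonneg)

lemma Sp_in_L2: "\<xi> \<in> Sp \<theta> p \<Longrightarrow> \<xi> \<in> L2 \<theta>"
  by (simp add: Sp_iff)

lemma S_subset_Sp: "0 \<le> p \<Longrightarrow> \<xi> \<in> S \<theta> \<Longrightarrow> \<xi> \<in> Sp \<theta> p"
  by (simp add: S_def)

lemma S_in_L2: "\<xi> \<in> S \<theta> \<Longrightarrow> \<xi> \<in> L2 \<theta>"
  by (rule Sp_in_L2[OF S_subset_Sp[OF order_refl]])

text \<open>The norm depends only on the moduli of the coefficients. The case \<open>r = 0\<close>
  handles the difference of an element with itself, positive \<open>r\<close> handles scalar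
  multiples.\<close>

lemma Sp_norm_cong:
  assumes "\<And>\<sigma>. finite \<sigma> \<Longrightarrow> cmod (coeff \<xi> \<sigma>) = r * cmod (coeff \<eta> \<sigma>)" "0 \<le> r"
  shows "Sp_norm \<theta> p \<xi> = r * Sp_norm \<theta> p \<eta>"
proof -
  have "(\<Sum>\<^sub>\<infinity>\<sigma>\<in>finsets. (wcoeff p \<xi> \<sigma>)\<^sup>2) = (\<Sum>\<^sub>\<infinity>\<sigma>\<in>finsets. r\<^sup>2 * (wcoeff p \<eta> \<sigma>)\<^sup>2)"
    using assms(1) by (intro infsum_cong) (simp add: wcoeff_def power_mult_distrib)
  then show ?thesis
    using \<open>0 \<le> r\<close> by (simp add: Sp_norm_eq infsum_cmult_right' real_sqrt_mult)
qed

lemma Sp_lincomb: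
  assumes \<xi>: "\<xi> \<in> Sp \<theta> p" and \<eta>: "\<eta> \<in> Sp \<theta> p"
  shows "l2_lincomb \<theta> a \<xi> b \<eta> \<in> Sp \<theta> p"
proof -
  have "(\<lambda>\<sigma>. (wcoeff p (l2_lincomb \<theta> a \<xi> b \<eta>) \<sigma>)\<^sup>2) summable_on finsets"
  proof (rule square_summable_triangle)
    show "(\<lambda>\<sigma>. (cmod a * wcoeff p \<xi> \<sigma>)\<^sup>2) summable_on finsets"
      "(\<lambda>\<sigma>. (cmod b * wcoeff p \<eta> \<sigma>)\<^sup>2) summable_on finsets"
      unfolding power_mult_distrib using \<xi> \<eta> by (auto simp: Sp_iff intro!: summable_on_cmult_right)
    fix \<sigma> assume "\<sigma> \<in> finsets"
    then have "cmod (coeff (l2_lincomb \<theta> a \<xi> b \<eta>) \<sigma>)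
        \<le> cmod a * cmod (coeff \<xi> \<sigma>) + cmod b * cmod (coeff \<eta> \<sigma>)"
      using \<xi> \<eta> Sp_in_L2 by (auto simp: coeff_lincomb intro: norm_triangle_le simp flip: norm_mult)
    then have "lam \<sigma> powr p * cmod (coeff (l2_lincomb \<theta> a \<xi> b \<eta>) \<sigma>)
        \<le> lam \<sigma> powr p * (cmod a * cmod (coeff \<xi> \<sigma>) + cmod b * cmod (coeff \<eta> \<sigma>))"
      by (rule mult_left_mono) simp
    then show "\<bar>wcoeff p (l2_lincomb \<theta> a \<xi> b \<eta>) \<sigma>\<bar>
        \<le> \<bar>cmod a * wcoeff p \<xi> \<sigma>\<bar> + \<bar>cmod b * wcoeff p \<eta> \<sigma>\<bar>"
      by (simp add: wcoeff_def abs_mult algebra_simps)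
  qed
  then show ?thesis using \<xi> \<eta> by (simp add: Sp_iff l2_lincomb_in_L2)
qed

lemma S_lincomb: "\<xi> \<in> S \<theta> \<Longrightarrow> \<eta> \<in> S \<theta> \<Longrightarrow> l2_lincomb \<theta> a \<xi> b \<eta> \<in> S \<theta>"
  by (simp add: S_def Sp_lincomb)

lemma Sp_diff: "\<xi> \<in> Sp \<theta> p \<Longrightarrow> \<eta> \<in> Sp \<theta> p \<Longrightarrow> l2_diff \<theta> \<xi> \<eta> \<in> Sp \<theta> p"
  unfolding l2_diff_def by (rule Sp_lincomb)

lemma Sp_norm_diff_triangle:
  assumes "\<xi> \<in> Sp \<theta> p" "\<eta> \<in> Sp \<theta> p" "\<zeta> \<in> Sp \<theta> p"
  shows "Sp_norm \<theta> p (l2_diff \<theta> \<xi> \<zeta>)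
    \<le> Sp_norm \<theta> p (l2_diff \<theta> \<xi> \<eta>) + Sp_norm \<theta> p (l2_diff \<theta> \<eta> \<zeta>)"
  unfolding Sp_norm_eq
proof (rule minkowski_infsum)
  show "(\<lambda>\<sigma>. (wcoeff p (l2_diff \<theta> \<xi> \<eta>) \<sigma>)\<^sup>2) summable_on finsets"
    "(\<lambda>\<sigma>. (wcoeff p (l2_diff \<theta> \<eta> \<zeta>) \<sigma>)\<^sup>2) summable_on finsets"
    using assms Sp_diff Sp_iff by blast+
  fix \<sigma> assume "\<sigma> \<in> finsets"
  then have "cmod (coeff (l2_diff \<theta> \<xi> \<zeta>) \<sigma>)
      \<le> cmod (coeff (l2_diff \<theta> \<xi> \<eta>) \<sigma>) + cmod (coeff (l2_diff \<theta> \<eta> \<zeta>) \<sigma>)"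
    using assms[THEN Sp_in_L2] norm_triangle_ineq[of "coeff \<xi> \<sigma> - coeff \<eta> \<sigma>" "coeff \<eta> \<sigma> - coeff \<zeta> \<sigma>"]
    by (simp add: coeff_diff)
  then have "lam \<sigma> powr p * cmod (coeff (l2_diff \<theta> \<xi> \<zeta>) \<sigma>)
      \<le> lam \<sigma> powr p * (cmod (coeff (l2_diff \<theta> \<xi> \<eta>) \<sigma>) + cmod (coeff (l2_diff \<theta> \<eta> \<zeta>) \<sigma>))"
    by (rule mult_left_mono) simp
  then show "\<bar>wcoeff p (l2_diff \<theta> \<xi> \<zeta>) \<sigma>\<bar>
      \<le> \<bar>wcoeff p (l2_diff \<theta> \<xi> \<eta>) \<sigma>\<bar> + \<bar>wcoeff p (l2_diff \<theta> \<eta> \<zeta>) \<sigma>\<bar>"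
    by (simp add: wcoeff_def algebra_simps)
qed

lemma Sp_norm_diff_self: "\<xi> \<in> L2 \<theta> \<Longrightarrow> Sp_norm \<theta> p (l2_diff \<theta> \<xi> \<xi>) = 0"
  using Sp_norm_cong[of "l2_diff \<theta> \<xi> \<xi>" 0 \<xi>] by (simp add: coeff_diff)

lemma coeff_Z: "finite \<sigma> \<Longrightarrow> finite \<tau> \<Longrightarrow> coeff (Z \<theta> \<tau>) \<sigma> = (if \<sigma> = \<tau> then 1 else 0)"
  by (simp add: Z_orthonormal)

lemma Z_in_Sp:
  assumes "finite \<sigma>"
  shows "Z \<theta> \<sigma> \<in> Sp \<theta> p"
proof -
  have "(\<lambda>\<tau>. (wcoeff p (Z \<theta> \<sigma>) \<tau>)\<^sup>2) summable_on finsets \<longleftrightarrow>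
      (\<lambda>\<tau>. (wcoeff p (Z \<theta> \<sigma>) \<tau>)\<^sup>2) summable_on {\<sigma>}"
    using assms by (intro summable_on_cong_neutral) (auto simp: wcoeff_def coeff_Z)
  then show ?thesis using assms by (simp add: Sp_iff Z_in_L2)
qed

lemma Z_in_S: "finite \<sigma> \<Longrightarrow> Z \<theta> \<sigma> \<in> S \<theta>"
  by (simp add: S_def Z_in_Sp)

text \<open>Supplies a unit vector, so that the suprema defining the dual norm and the operator norm
  run over nonempty sets.\<close>

lemma Sp_norm_Z_empty: "Sp_norm \<theta> p (Z \<theta> {}) = 1"
proof -
  have "(\<Sum>\<^sub>\<infinity>\<tau>\<in>finsets. (wcoeff p (Z \<theta> {}) \<tau>)\<^sup>2) = (\<Sum>\<^sub>\<infinity>\<tau>\<in>{{}}. (wcoeff p (Z \<theta> {}) \<tau>)\<^sup>2)"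
    by (intro infsum_cong_neutral) (auto simp: wcoeff_def coeff_Z)
  also have "\<dots> = 1" by (simp add: wcoeff_def coeff_Z lam_def)
  finally show ?thesis by (simp add: Sp_norm_eq)
qed

section \<open>Finite partial sums of the expansion in the \<open>Z \<theta> \<sigma>\<close> and
  their convergence\<close>

definition linear_functional :: "l2 set \<Rightarrow> (l2 \<Rightarrow> complex) \<Rightarrow> bool" where
  "linear_functional V \<Phi> \<longleftrightarrow>
     (\<forall>\<xi>\<in>V. \<forall>\<eta>\<in>V. \<forall>a b. \<Phi> (l2_lincomb \<theta> a \<xi> b \<eta>) = a * \<Phi> \<xi> + b * \<Phi> \<eta>)"

text \<open>Addition is available only as the binary \<open>l2_lincomb\<close>, so the finite sum is
  built by induction. It is recorded through its coefficients, which control the norms, and through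
  the values of linear functionals on it.\<close>

lemma ex_finite_combination:
  assumes "finite F" "F \<subseteq> finsets"
  shows "\<exists>\<zeta>\<in>S \<theta>. (\<forall>\<tau>\<in>finsets. coeff \<zeta> \<tau> = (if \<tau> \<in> F then a \<tau> else 0)) \<and>
    (\<forall>\<Phi>. linear_functional (S \<theta>) \<Phi> \<longrightarrow> \<Phi> \<zeta> = (\<Sum>\<sigma>\<in>F. a \<sigma> * \<Phi> (Z \<theta> \<sigma>)))"
  using assms
proof induction
  case empty
  show ?case
    \<comment> \<open>The empty sum is the zero vector, written as a combination with both scalars
      zero.\<close>
    by (rule bexI[of _ "l2_lincomb \<theta> 0 (Z \<theta> {}) 0 (Z \<theta> {})"])
      (auto simp: S_lincomb Z_in_S coeff_lincomb Z_in_L2 linear_functional_def)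
next
  case (insert \<sigma> F)
  then obtain \<zeta> where \<zeta>: "\<zeta> \<in> S \<theta>" "\<And>\<tau>. finite \<tau> \<Longrightarrow> coeff \<zeta> \<tau> = (if \<tau> \<in> F then a \<tau> else 0)"
    "\<And>\<Phi>. linear_functional (S \<theta>) \<Phi> \<Longrightarrow> \<Phi> \<zeta> = (\<Sum>\<sigma>\<in>F. a \<sigma> * \<Phi> (Z \<theta> \<sigma>))"
    by auto
  have \<sigma>: "finite \<sigma>" using insert by auto
  show ?case
  proof (intro bexI conjI ballI allI impI)
    show "l2_lincomb \<theta> (a \<sigma>) (Z \<theta> \<sigma>) 1 \<zeta> \<in> S \<theta>"
      using \<zeta> \<sigma> by (simp add: S_lincomb Z_in_S)
    show "coeff (l2_lincomb \<theta> (a \<sigma>) (Z \<theta> \<sigma>) 1 \<zeta>) \<tau> = (if \<tau> \<in> insert \<sigma> F then a \<tau> else 0)"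
      if "\<tau> \<in> finsets" for \<tau>
      using that \<sigma> \<zeta> insert.hyps by (auto simp: coeff_lincomb Z_in_L2 S_in_L2 coeff_Z)
    show "\<Phi> (l2_lincomb \<theta> (a \<sigma>) (Z \<theta> \<sigma>) 1 \<zeta>) = (\<Sum>\<sigma>\<in>insert \<sigma> F. a \<sigma> * \<Phi> (Z \<theta> \<sigma>))"
      if "linear_functional (S \<theta>) \<Phi>" for \<Phi>
      using that \<sigma> \<zeta>(1) \<zeta>(3)[OF that] insert.hyps by (simp add: linear_functional_def Z_in_S)
  qed
qed

definition psum :: "l2 \<Rightarrow> nat set set \<Rightarrow> l2" where
  "psum \<xi> F = (SOME \<zeta>. \<zeta> \<in> S \<theta> \<and> (\<forall>\<tau>\<in>finsets. coeff \<zeta> \<tau> = (if \<tau> \<in> F then coeff \<xi> \<tau> else 0)) \<and>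
    (\<forall>\<Phi>. linear_functional (S \<theta>) \<Phi> \<longrightarrow> \<Phi> \<zeta> = (\<Sum>\<sigma>\<in>F. coeff \<xi> \<sigma> * \<Phi> (Z \<theta> \<sigma>))))"

lemma
  assumes "finite F" "F \<subseteq> finsets"
  shows psum_in_S: "psum \<xi> F \<in> S \<theta>"
    and coeff_psum: "finite \<tau> \<Longrightarrow> coeff (psum \<xi> F) \<tau> = (if \<tau> \<in> F then coeff \<xi> \<tau> else 0)"
    and linear_psum: "linear_functional (S \<theta>) \<Phi> \<Longrightarrow> \<Phi> (psum \<xi> F) = (\<Sum>\<sigma>\<in>F. coeff \<xi> \<sigma> * \<Phi> (Z \<theta> \<sigma>))"
  using ex_finite_combination[OF assms, of "coeff \<xi>", unfolded Bex_def, THEN someI_ex,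
      folded psum_def] by auto

text \<open>The coefficients of the difference vanish on \<open>F\<close> and are those of -\<xi>
  outside it, so the squared distance is the tail of the convergent series for the squared norm of
  \<xi>.\<close>

lemma psum_tendsto:
  assumes \<xi>: "\<xi> \<in> Sp \<theta> p"
  shows "((\<lambda>F. Sp_norm \<theta> p (l2_diff \<theta> (psum \<xi> F) \<xi>)) \<longlongrightarrow> 0) (finite_subsets_at_top finsets)"
proof -
  let ?f = "\<lambda>\<sigma>. (wcoeff p \<xi> \<sigma>)\<^sup>2"
  have f: "?f summable_on finsets" using \<xi> by (simp add: Sp_iff)
  have eq: "Sp_norm \<theta> p (l2_diff \<theta> (psum \<xi> F) \<xi>) = sqrt (infsum ?f finsets - sum ?f F)"
    if F: "finite F" "F \<subseteq> finsets" for F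
  proof -
    have "(\<Sum>\<^sub>\<infinity>\<sigma>\<in>finsets. (wcoeff p (l2_diff \<theta> (psum \<xi> F) \<xi>) \<sigma>)\<^sup>2) = infsum ?f (finsets - F)"
      using \<xi>[THEN Sp_in_L2] psum_in_S[OF F, THEN S_in_L2] coeff_psum[OF F]
      by (intro infsum_cong_neutral) (auto simp: wcoeff_def coeff_diff)
    also have "\<dots> = infsum ?f finsets - sum ?f F"
      using F f by (subst infsum_Diff) auto
    finally show ?thesis by (simp add: Sp_norm_eq)
  qed
  have "((\<lambda>F. sqrt (infsum ?f finsets - sum ?f F)) \<longlongrightarrow> sqrt (infsum ?f finsets - infsum ?f finsets))
      (finite_subsets_at_top finsets)"
    by (intro tendsto_intros infsum_tendsto f)
  then have "((\<lambda>F. sqrt (infsum ?f finsets - sum ?f F)) \<longlongrightarrow> 0) (finite_subsets_at_top finsets)"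
    by simp
  then show ?thesis
    by (rule Lim_transform_eventually)
      (auto intro!: eventually_finite_subsets_at_top_weakI simp: eq)
qed

text \<open>One statement for two topologies: \<open>P = {0..}\<close> gives that of
  \<open>S \<theta>\<close>, and \<open>P = {p}\<close> that of
  \<open>Sp \<theta> p\<close>.\<close>

lemma limitin_Sp_topologies:
  assumes "P \<noteq> {}" and \<xi>: "\<xi> \<in> (\<Inter>p\<in>P. Sp \<theta> p)"
    and f: "eventually (\<lambda>i. f i \<in> (\<Inter>p\<in>P. Sp \<theta> p)) F"
    and lim: "\<And>p. p \<in> P \<Longrightarrow> ((\<lambda>i. Sp_norm \<theta> p (l2_diff \<theta> (f i) \<xi>)) \<longlongrightarrow> 0) F"
  shows "limitin (seminorm_topology (\<Inter>p\<in>P. Sp \<theta> p) (l2_diff \<theta>) (Sp_norm \<theta> ` P)) f \<xi> F"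
  using assms Sp_in_L2
  by (intro limitin_seminorm_topology) (auto intro!: Sp_norm_diff_triangle Sp_norm_diff_self)

lemma S_topology_eq:
  "S_topology \<theta> = seminorm_topology (\<Inter>p\<in>{0..}. Sp \<theta> p) (l2_diff \<theta>) (Sp_norm \<theta> ` {0..})"
proof -
  have "{Sp_norm \<theta> p | p. p \<ge> 0} = Sp_norm \<theta> ` {0..}" by auto
  then show ?thesis by (simp add: S_topology_def S_def)
qed

lemma Sp_topology_eq:
  "Sp_topology \<theta> p = seminorm_topology (\<Inter>p\<in>{p}. Sp \<theta> p) (l2_diff \<theta>) (Sp_norm \<theta> ` {p})"
  by (simp add: Sp_topology_def)

lemma eventually_psum_in_S: "eventually (\<lambda>F. psum \<xi> F \<in> S \<theta>) (finite_subsets_at_top finsets)"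
  by (intro eventually_finite_subsets_at_top_weakI psum_in_S) auto

lemma psum_limitin_S:
  assumes "\<xi> \<in> S \<theta>"
  shows "limitin (S_topology \<theta>) (psum \<xi>) \<xi> (finite_subsets_at_top finsets)"
  unfolding S_topology_eq
  by (rule limitin_Sp_topologies)
    (use assms eventually_psum_in_S in \<open>auto simp: S_def intro!: psum_tendsto\<close>)

lemma psum_limitin_Sp:
  assumes "0 \<le> p" "\<xi> \<in> Sp \<theta> p"
  shows "limitin (Sp_topology \<theta> p) (psum \<xi>) \<xi> (finite_subsets_at_top finsets)"
  unfolding Sp_topology_eq
proof (rule limitin_Sp_topologies)
  show "\<forall>\<^sub>F F in finite_subsets_at_top finsets. psum \<xi> F \<in> (\<Inter>p\<in>{p}. Sp \<theta> p)"
    using eventually_psum_in_S by eventually_elim (use assms S_subset_Sp in auto)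
qed (use assms in \<open>auto intro!: psum_tendsto\<close>)

text \<open>By linearity, \<Phi> at \<open>psum \<xi> F\<close> is the partial sum over
  \<open>F\<close>, and \<open>has_sum\<close> is convergence of exactly these sums along the finite
  subsets.\<close>

lemma has_sum_of_psum_tendsto:
  assumes "linear_functional (S \<theta>) \<Phi>"
    and "((\<lambda>F. \<Phi> (psum \<xi> F)) \<longlongrightarrow> l) (finite_subsets_at_top finsets)"
  shows "((\<lambda>\<sigma>. coeff \<xi> \<sigma> * \<Phi> (Z \<theta> \<sigma>)) has_sum l) finsets"
  unfolding has_sum_def using assms(2)
  by (rule Lim_transform_eventually)
    (auto intro!: eventually_finite_subsets_at_top_weakI linear_psum assms(1))

lemma dual_expansion:
  assumes \<Phi>: "\<Phi> \<in> dual \<theta> V X" and V: "S \<theta> \<subseteq> V"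
    and lim: "limitin X (psum \<xi>) \<xi> (finite_subsets_at_top finsets)"
  shows "((\<lambda>\<sigma>. coeff \<xi> \<sigma> * \<Phi> (Z \<theta> \<sigma>)) has_sum \<Phi> \<xi>) finsets"
proof (rule has_sum_of_psum_tendsto)
  show "linear_functional (S \<theta>) \<Phi>"
    using \<Phi> V by (auto simp: dual_def linear_functional_def subset_iff)
  have "continuous_map X euclidean \<Phi>" using \<Phi> by (simp add: dual_def)
  then show "((\<lambda>F. \<Phi> (psum \<xi> F)) \<longlongrightarrow> \<Phi> \<xi>) (finite_subsets_at_top finsets)"
    using continuous_map_limit[OF _ lim] by (fastforce simp: o_def)
qed

lemmas S_dual_expansion =
  dual_expansion[OF _ order_refl psum_limitin_S, folded S_dual_def]

lemma Sp_dual_expansion: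
  assumes "\<Phi> \<in> Sp_dual \<theta> p" "0 \<le> p" "\<xi> \<in> Sp \<theta> p"
  shows "((\<lambda>\<sigma>. coeff \<xi> \<sigma> * \<Phi> (Z \<theta> \<sigma>)) has_sum \<Phi> \<xi>) finsets"
  using assms psum_limitin_Sp
  by (intro dual_expansion[of _ "Sp \<theta> p" "Sp_topology \<theta> p"]) (auto simp: Sp_dual_def S_subset_Sp)


section \<open>Bounded functionals and operators\<close>

lemma linear_functional_scale:
  "\<lbrakk>linear_functional V \<Phi>; \<xi> \<in> V\<rbrakk> \<Longrightarrow> \<Phi> (l2_lincomb \<theta> a \<xi> 0 \<xi>) = a * \<Phi> \<xi>"
  by (simp add: linear_functional_def)

lemma linear_functional_diff:
  "\<lbrakk>linear_functional V \<Phi>; \<xi> \<in> V; \<eta> \<in> V\<rbrakk> \<Longrightarrow> \<Phi> (l2_diff \<theta> \<xi> \<eta>) = \<Phi> \<xi> - \<Phi> \<eta>"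
  by (simp add: linear_functional_def l2_diff_def)

lemma Sp_dual_linear: "\<Phi> \<in> Sp_dual \<theta> p \<Longrightarrow> linear_functional (Sp \<theta> p) \<Phi>"
  by (simp add: Sp_dual_def dual_def linear_functional_def)

lemma Sp_norm_scale:
  "\<xi> \<in> L2 \<theta> \<Longrightarrow> Sp_norm \<theta> p (l2_lincomb \<theta> a \<xi> 0 \<xi>) = cmod a * Sp_norm \<theta> p \<xi>"
  by (rule Sp_norm_cong) (simp_all add: coeff_lincomb norm_mult)

text \<open>Needed because the supremum of an unbounded set of reals is unspecified.\<close>

lemma Sp_dual_bdd_above:
  assumes \<Phi>: "\<Phi> \<in> Sp_dual \<theta> p"
  shows "bdd_above {cmod (\<Phi> \<xi>) | \<xi>. \<xi> \<in> Sp \<theta> p \<and> Sp_norm \<theta> p \<xi> \<le> 1}"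
proof (rule ccontr)
  assume unb: "\<not> ?thesis"
  have "\<exists>\<xi>. \<xi> \<in> Sp \<theta> p \<and> Sp_norm \<theta> p \<xi> \<le> 1 \<and> real (Suc n) < cmod (\<Phi> \<xi>)" for n
  proof (rule ccontr)
    assume "\<nexists>\<xi>. \<xi> \<in> Sp \<theta> p \<and> Sp_norm \<theta> p \<xi> \<le> 1 \<and> real (Suc n) < cmod (\<Phi> \<xi>)"
    then have "bdd_above {cmod (\<Phi> \<xi>) | \<xi>. \<xi> \<in> Sp \<theta> p \<and> Sp_norm \<theta> p \<xi> \<le> 1}"
      by (intro bdd_aboveI[of _ "real (Suc n)"]) (force simp: not_less)
    with unb show False ..
  qed
  then obtain y where y: "y n \<in> Sp \<theta> p" "Sp_norm \<theta> p (y n) \<le> 1" "real (Suc n) < cmod (\<Phi> (y n))" for n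
    by metis
  \<comment> \<open>Here \<open>u\<close> is the zero vector. The \<open>x n\<close> tend to it
    because \<open>y n\<close> has norm at most 1 and is divided by \<open>Suc n\<close>, while
    |\<Phi>(x n)| stays above 1; this contradicts continuity at zero.\<close>
  define u where "u = l2_lincomb \<theta> 0 (Z \<theta> {}) 0 (Z \<theta> {})"
  define x where "x n = l2_lincomb \<theta> (complex_of_real (inverse (real (Suc n)))) (y n) 0 (y n)" for n
  have Sp: "u \<in> Sp \<theta> p" "x n \<in> Sp \<theta> p" for n
    using y by (simp_all add: u_def x_def Sp_lincomb Z_in_Sp)
  have norm: "Sp_norm \<theta> p (l2_diff \<theta> (x n) u) = inverse (real (Suc n)) * Sp_norm \<theta> p (y n)" for n
  proof (rule Sp_norm_cong)
    fix \<sigma> :: "nat set" assume "finite \<sigma>"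
    then have "coeff (l2_diff \<theta> (x n) u) \<sigma> = complex_of_real (inverse (real (Suc n))) * coeff (y n) \<sigma>"
      using Sp[THEN Sp_in_L2] y(1)[THEN Sp_in_L2]
      by (simp add: coeff_diff) (simp add: x_def u_def coeff_lincomb Z_in_L2)
    then show "cmod (coeff (l2_diff \<theta> (x n) u) \<sigma>) = inverse (real (Suc n)) * cmod (coeff (y n) \<sigma>)"
      by (simp only: norm_mult norm_of_real) simp
  qed simp
  have "(\<lambda>n. Sp_norm \<theta> p (l2_diff \<theta> (x n) u)) \<longlonglongrightarrow> 0"
  proof (rule tendsto_sandwich[OF _ _ tendsto_const LIMSEQ_inverse_real_of_nat])
    show "\<forall>\<^sub>F n in sequentially. 0 \<le> Sp_norm \<theta> p (l2_diff \<theta> (x n) u)"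
      by (simp add: Sp_norm_nonneg)
    have "inverse (real (Suc n)) * Sp_norm \<theta> p (y n) \<le> inverse (real (Suc n)) * 1" for n
      using y(2) by (intro mult_left_mono) simp_all
    then show "\<forall>\<^sub>F n in sequentially. Sp_norm \<theta> p (l2_diff \<theta> (x n) u) \<le> inverse (real (Suc n))"
      unfolding norm by simp
  qed
  then have "limitin (Sp_topology \<theta> p) x u sequentially"
    unfolding Sp_topology_eq using Sp by (intro limitin_Sp_topologies) auto
  moreover have "continuous_map (Sp_topology \<theta> p) euclidean \<Phi>"
    using \<Phi> by (simp add: Sp_dual_def dual_def)
  ultimately have "(\<lambda>n. \<Phi> (x n)) \<longlonglongrightarrow> \<Phi> u"
    using continuous_map_limit by (fastforce simp: comp_def)
  moreover have "\<Phi> u = 0"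
    using Sp_dual_linear[OF \<Phi>] by (simp add: u_def linear_functional_scale Z_in_Sp)
  ultimately have "\<forall>\<^sub>F n in sequentially. cmod (\<Phi> (x n)) < 1"
    using tendsto_norm_zero order_tendstoD(2) zero_less_one by metis
  then obtain n where n: "cmod (\<Phi> (x n)) < 1"
    by (auto simp: eventually_sequentially)
  have "\<Phi> (x n) = complex_of_real (inverse (real (Suc n))) * \<Phi> (y n)"
    using Sp_dual_linear[OF \<Phi>] y by (simp add: x_def linear_functional_scale)
  then have "cmod (\<Phi> (x n)) = cmod (\<Phi> (y n)) / real (Suc n)"
    by (simp only: norm_mult norm_of_real) (simp add: divide_inverse mult.commute)
  then show False using n y(3)[of n] by (simp add: divide_less_eq del: of_nat_Suc)
qed

text \<open>Scaling by 1/t moves \<xi> into the unit ball. Using a positive bound \<open>t\<close>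
  in place of the norm covers vectors of norm zero without a separate case.\<close>

lemma Sp_dual_norm_bound:
  assumes \<Phi>: "\<Phi> \<in> Sp_dual \<theta> p" and \<xi>: "\<xi> \<in> Sp \<theta> p" and t: "Sp_norm \<theta> p \<xi> \<le> t" "0 < t"
  shows "cmod (\<Phi> \<xi>) \<le> t * Sp_dual_norm \<theta> p \<Phi>"
proof -
  let ?\<eta> = "l2_lincomb \<theta> (complex_of_real (1 / t)) \<xi> 0 \<xi>"
  have "Sp_norm \<theta> p ?\<eta> \<le> 1"
    using t \<xi> by (simp add: Sp_norm_scale Sp_in_L2 norm_divide)
  then have "cmod (\<Phi> ?\<eta>) \<le> Sp_dual_norm \<theta> p \<Phi>"
    unfolding Sp_dual_norm_def using \<xi> Sp_lincomb
    by (intro cSup_upper Sp_dual_bdd_above[OF \<Phi>]) blast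
  moreover have "\<Phi> ?\<eta> = complex_of_real (1 / t) * \<Phi> \<xi>"
    using Sp_dual_linear[OF \<Phi>] \<xi> by (rule linear_functional_scale)
  ultimately have "cmod (\<Phi> \<xi>) / t \<le> Sp_dual_norm \<theta> p \<Phi>"
    using t by (simp add: norm_mult norm_divide)
  then show ?thesis using t by (simp add: field_simps)
qed

text \<open>Boundedness gives continuity through the estimate of \<Phi> on differences, and the
  bound \<open>M\<close> then holds for every value in the supremum over the unit ball.\<close>

lemma
  assumes ext: "\<Phi> \<in> extensional (Sp \<theta> p)" and lin: "linear_functional (Sp \<theta> p) \<Phi>"
    and M: "\<And>\<xi>. \<xi> \<in> Sp \<theta> p \<Longrightarrow> cmod (\<Phi> \<xi>) \<le> M * Sp_norm \<theta> p \<xi>" "0 \<le> M"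
  shows bounded_functional_in_Sp_dual: "\<Phi> \<in> Sp_dual \<theta> p"
    and Sp_dual_norm_le: "Sp_dual_norm \<theta> p \<Phi> \<le> M"
proof -
  have ball: "openin (Sp_topology \<theta> p) {\<eta> \<in> Sp \<theta> p. Sp_norm \<theta> p (l2_diff \<theta> \<eta> \<xi>) < \<epsilon>}"
    if "\<xi> \<in> Sp \<theta> p" "0 < \<epsilon>" for \<xi> \<epsilon>
    unfolding Sp_topology_def using that by (intro openin_seminorm_ball) simp_all
  have "topspace (Sp_topology \<theta> p) \<subseteq> Sp \<theta> p"
    unfolding Sp_topology_def seminorm_topology_def topology_generated_by_topspace by auto
  moreover have "openin (Sp_topology \<theta> p) {\<xi> \<in> topspace (Sp_topology \<theta> p). \<Phi> \<xi> \<in> U}" if U: "open U" for U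
  proof (subst openin_subopen, rule ballI)
    fix \<xi> assume "\<xi> \<in> {\<xi> \<in> topspace (Sp_topology \<theta> p). \<Phi> \<xi> \<in> U}"
    then have \<xi>: "\<xi> \<in> Sp \<theta> p" "\<Phi> \<xi> \<in> U" using calculation by auto
    obtain e where e: "0 < e" "\<And>w. dist w (\<Phi> \<xi>) < e \<Longrightarrow> w \<in> U"
      using U \<xi>(2) by (auto simp: open_dist)
    \<comment> \<open>The denominator \<open>M + 1\<close> stays positive when \<open>M\<close> is
      0.\<close>
    let ?B = "{\<eta> \<in> Sp \<theta> p. Sp_norm \<theta> p (l2_diff \<theta> \<eta> \<xi>) < e / (M + 1)}"
    have op: "openin (Sp_topology \<theta> p) ?B" using \<xi> e M by (intro ball) simp_all
    moreover have "\<xi> \<in> ?B" using \<xi> e M by (simp add: Sp_norm_diff_self Sp_in_L2)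
    moreover have "\<Phi> \<eta> \<in> U" if \<eta>: "\<eta> \<in> ?B" for \<eta>
    proof -
      let ?n = "Sp_norm \<theta> p (l2_diff \<theta> \<eta> \<xi>)"
      have "dist (\<Phi> \<eta>) (\<Phi> \<xi>) = cmod (\<Phi> (l2_diff \<theta> \<eta> \<xi>))"
        using lin \<eta> \<xi> by (simp add: dist_norm linear_functional_diff)
      also have "\<dots> \<le> M * ?n" using \<eta> \<xi> by (simp add: M Sp_diff)
      also have "\<dots> \<le> (M + 1) * ?n" using Sp_norm_nonneg by (simp add: mult_right_mono)
      also have "\<dots> < e" using \<eta> M(2) by (simp add: field_simps)
      finally show ?thesis by (rule e)
    qed
    ultimately show "\<exists>W. openin (Sp_topology \<theta> p) W \<and> \<xi> \<in> W \<and>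
        W \<subseteq> {\<xi> \<in> topspace (Sp_topology \<theta> p). \<Phi> \<xi> \<in> U}"
      using openin_subset[OF op] by (intro exI[of _ ?B]) blast
  qed
  ultimately have "continuous_map (Sp_topology \<theta> p) euclidean \<Phi>"
    by (simp add: continuous_map_def)
  then show "\<Phi> \<in> Sp_dual \<theta> p"
    using ext lin by (simp add: Sp_dual_def dual_def linear_functional_def)
  show "Sp_dual_norm \<theta> p \<Phi> \<le> M"
    unfolding Sp_dual_norm_def
  proof (rule cSup_least)
    show "{cmod (\<Phi> \<xi>) | \<xi>. \<xi> \<in> Sp \<theta> p \<and> Sp_norm \<theta> p \<xi> \<le> 1} \<noteq> {}"
      using Z_in_Sp[of "{}"] Sp_norm_Z_empty by force
    fix x assume "x \<in> {cmod (\<Phi> \<xi>) | \<xi>. \<xi> \<in> Sp \<theta> p \<and> Sp_norm \<theta> p \<xi> \<le> 1}"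
    then obtain \<xi> where "x = cmod (\<Phi> \<xi>)" "\<xi> \<in> Sp \<theta> p" "Sp_norm \<theta> p \<xi> \<le> 1" by auto
    then show "x \<le> M" using M(1)[of \<xi>] mult_left_le[OF _ M(2), of "Sp_norm \<theta> p \<xi>"] by simp
  qed
qed

text \<open>With \<eta> fixed, the operator bound applied to \<open>psum \<xi> F\<close> minus \<xi>
  makes the values converge, so the first argument can be expanded.\<close>

lemma bounded_op_expansion:
  assumes T: "T \<in> bounded_Sp_ops \<theta> q" and q: "0 \<le> q"
    and \<xi>: "\<xi> \<in> Sp \<theta> q" and \<eta>: "\<eta> \<in> Sp \<theta> q"
  shows "((\<lambda>\<sigma>. coeff \<xi> \<sigma> * T (Z \<theta> \<sigma>) \<eta>) has_sum T \<xi> \<eta>) finsets"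
proof (rule has_sum_of_psum_tendsto[of "\<lambda>\<xi>. T \<xi> \<eta>"])
  have lin: "linear_functional (Sp \<theta> q) (\<lambda>\<xi>. T \<xi> \<eta>)"
    using T \<eta> by (auto simp: bounded_Sp_ops_def linear_op_def linear_functional_def)
  then show "linear_functional (S \<theta>) (\<lambda>\<xi>. T \<xi> \<eta>)"
    using q by (simp add: linear_functional_def S_subset_Sp)
  obtain K where K: "\<And>\<xi>. \<xi> \<in> Sp \<theta> q \<Longrightarrow> Sp_dual_norm \<theta> q (T \<xi>) \<le> K * Sp_norm \<theta> q \<xi>"
    using T by (auto simp: bounded_Sp_ops_def)
  \<comment> \<open>Adding 1 provides the strictly positive bound that
    \<open>Sp_dual_norm_bound\<close> asks for.\<close>
  let ?t = "Sp_norm \<theta> q \<eta> + 1"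
  have t: "0 < ?t" using Sp_norm_nonneg[of q \<eta>] by simp
  have le: "cmod (T (psum \<xi> F) \<eta> - T \<xi> \<eta>) \<le> ?t * (K * Sp_norm \<theta> q (l2_diff \<theta> (psum \<xi> F) \<xi>))"
    if "psum \<xi> F \<in> S \<theta>" for F
  proof -
    have d: "psum \<xi> F \<in> Sp \<theta> q" "l2_diff \<theta> (psum \<xi> F) \<xi> \<in> Sp \<theta> q"
      using that q \<xi> by (simp_all add: S_subset_Sp Sp_diff)
    then have "T (l2_diff \<theta> (psum \<xi> F) \<xi>) \<in> Sp_dual \<theta> q"
      using T by (auto simp: bounded_Sp_ops_def)
    then have "cmod (T (l2_diff \<theta> (psum \<xi> F) \<xi>) \<eta>)
        \<le> ?t * Sp_dual_norm \<theta> q (T (l2_diff \<theta> (psum \<xi> F) \<xi>))"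
      using \<eta> t by (intro Sp_dual_norm_bound) simp_all
    also have "\<dots> \<le> ?t * (K * Sp_norm \<theta> q (l2_diff \<theta> (psum \<xi> F) \<xi>))"
      using t d by (intro mult_left_mono K) simp_all
    finally show ?thesis
      using linear_functional_diff[OF lin d(1) \<xi>] by simp
  qed
  have "((\<lambda>F. T (psum \<xi> F) \<eta> - T \<xi> \<eta>) \<longlongrightarrow> 0) (finite_subsets_at_top finsets)"
  proof (rule Lim_null_comparison)
    show "\<forall>\<^sub>F F in finite_subsets_at_top finsets. cmod (T (psum \<xi> F) \<eta> - T \<xi> \<eta>)
        \<le> ?t * (K * Sp_norm \<theta> q (l2_diff \<theta> (psum \<xi> F) \<xi>))"
      using eventually_psum_in_S by eventually_elim (rule le)
    show "((\<lambda>F. ?t * (K * Sp_norm \<theta> q (l2_diff \<theta> (psum \<xi> F) \<xi>))) \<longlongrightarrow> 0) (finite_subsets_at_top finsets)"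
      by (intro tendsto_mult_right_zero psum_tendsto \<xi>)
  qed
  then show "((\<lambda>F. T (psum \<xi> F) \<eta>) \<longlongrightarrow> T \<xi> \<eta>) (finite_subsets_at_top finsets)"
    by (simp only: Lim_null[symmetric])
qed

text \<open>Expanding the second argument by continuity of the functionals gives equality at each
  \<open>Z \<theta> \<sigma>\<close>; expanding the first by boundedness gives it everywhere on the
  carrier. Extensionality, of the functionals and then of the operators, turns this into equality of
  functions.\<close>

lemma bounded_op_eqI:
  assumes T: "T \<in> bounded_Sp_ops \<theta> q" and U: "U \<in> bounded_Sp_ops \<theta> q" and q: "0 \<le> q"
    and eq: "\<And>\<sigma> \<tau>. finite \<sigma> \<Longrightarrow> finite \<tau> \<Longrightarrow> T (Z \<theta> \<sigma>) (Z \<theta> \<tau>) = U (Z \<theta> \<sigma>) (Z \<theta> \<tau>)"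
  shows "T = U"
proof -
  have dual: "T \<xi> \<in> Sp_dual \<theta> q" "U \<xi> \<in> Sp_dual \<theta> q" if "\<xi> \<in> Sp \<theta> q" for \<xi>
    using that T U by (auto simp: bounded_Sp_ops_def)
  have Z: "T (Z \<theta> \<sigma>) \<eta> = U (Z \<theta> \<sigma>) \<eta>" if \<sigma>: "finite \<sigma>" and \<eta>: "\<eta> \<in> Sp \<theta> q" for \<sigma> \<eta>
  proof -
    have "((\<lambda>\<tau>. coeff \<eta> \<tau> * T (Z \<theta> \<sigma>) (Z \<theta> \<tau>)) has_sum T (Z \<theta> \<sigma>) \<eta>) finsets"
      using \<sigma> \<eta> q dual by (intro Sp_dual_expansion) (simp_all add: Z_in_Sp)
    moreover have "((\<lambda>\<tau>. coeff \<eta> \<tau> * U (Z \<theta> \<sigma>) (Z \<theta> \<tau>)) has_sum U (Z \<theta> \<sigma>) \<eta>) finsets"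
      using \<sigma> \<eta> q dual by (intro Sp_dual_expansion) (simp_all add: Z_in_Sp)
    ultimately show ?thesis
      using \<sigma> eq by (metis (no_types, lifting) has_sum_cong infsumI mem_Collect_eq)
  qed
  have "T \<xi> \<eta> = U \<xi> \<eta>" if \<xi>: "\<xi> \<in> Sp \<theta> q" and \<eta>: "\<eta> \<in> Sp \<theta> q" for \<xi> \<eta>
    using bounded_op_expansion[OF T q \<xi> \<eta>] bounded_op_expansion[OF U q \<xi> \<eta>] Z[OF _ \<eta>]
    by (metis (no_types, lifting) has_sum_cong infsumI mem_Collect_eq)
  moreover have "T \<xi> \<in> extensional (Sp \<theta> q)" "U \<xi> \<in> extensional (Sp \<theta> q)" if "\<xi> \<in> Sp \<theta> q" for \<xi>
    using dual[OF that] by (auto simp: Sp_dual_def dual_def)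
  ultimately have "T \<xi> = U \<xi>" if "\<xi> \<in> Sp \<theta> q" for \<xi>
    using that by (metis extensionalityI)
  moreover have "T \<in> extensional (Sp \<theta> q)" "U \<in> extensional (Sp \<theta> q)"
    using T U by (auto simp: bounded_Sp_ops_def PiE_def)
  ultimately show ?thesis by (metis extensionalityI)
qed

text \<open>
  A singleton \<open>{\<eta>}\<close> is bounded, so evaluation at \<open>\<eta>\<close> is continuous for the strong topology.
\<close>

lemma S_op_expansion:
  assumes T: "continuous_linear_S_op \<theta> T" and \<xi>: "\<xi> \<in> S \<theta>" and \<eta>: "\<eta> \<in> S \<theta>"
  shows "((\<lambda>\<sigma>. coeff \<xi> \<sigma> * T (Z \<theta> \<sigma>) \<eta>) has_sum T \<xi> \<eta>) finsets"
proof (rule has_sum_of_psum_tendsto[of "\<lambda>\<xi>. T \<xi> \<eta>"])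
  show "linear_functional (S \<theta>) (\<lambda>\<xi>. T \<xi> \<eta>)"
    using T \<eta> by (auto simp: continuous_linear_S_op_def linear_op_def linear_functional_def)
  have dual: "T \<xi> \<in> S_dual \<theta>"
    using T \<xi> by (auto simp: continuous_linear_S_op_def)
  have "limitin (S_dual_topology \<theta>) (T \<circ> psum \<xi>) (T \<xi>) (finite_subsets_at_top finsets)"
    using T psum_limitin_S[OF \<xi>] by (intro continuous_map_limit) (auto simp: continuous_linear_S_op_def)
  note lim = limitinD[OF this]
  let ?q = "\<lambda>\<Phi>. SUP \<zeta>\<in>{\<eta>}. cmod (\<Phi> \<zeta>)" and ?d = "\<lambda>\<Phi> \<Psi>. \<lambda>\<xi>\<in>S \<theta>. \<Phi> \<xi> - \<Psi> \<xi>"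
  show "((\<lambda>F. T (psum \<xi> F) \<eta>) \<longlongrightarrow> T \<xi> \<eta>) (finite_subsets_at_top finsets)"
  proof (rule tendstoI)
    fix e :: real assume e: "0 < e"
    let ?U = "{\<Psi> \<in> S_dual \<theta>. ?q (?d \<Psi> (T \<xi>)) < e}"
    have "S_bounded \<theta> {\<eta>}" using \<eta> by (simp add: S_bounded_def)
    then have "?q \<in> {\<lambda>\<Phi>. SUP \<xi>\<in>B. cmod (\<Phi> \<xi>) | B. S_bounded \<theta> B \<and> B \<noteq> {}}" by blast
    then have "openin (S_dual_topology \<theta>) ?U"
      unfolding S_dual_topology_def using dual e by (rule openin_seminorm_ball)
    moreover have "T \<xi> \<in> ?U" using dual e \<eta> by simp
    ultimately have "\<forall>\<^sub>F F in finite_subsets_at_top finsets. (T \<circ> psum \<xi>) F \<in> ?U"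
      by (rule lim)
    then show "\<forall>\<^sub>F F in finite_subsets_at_top finsets. dist (T (psum \<xi> F) \<eta>) (T \<xi> \<eta>) < e"
      by eventually_elim (use \<eta> in \<open>simp add: dist_norm\<close>)
  qed
qed


section \<open>The operator with a given kernel\<close>

text \<open>The value at \<xi> of the functional prescribed as \<open>k \<sigma>\<close> on
  \<open>Z \<theta> \<sigma>\<close>. An \<open>infsum\<close> without convergence is 0, so
  linearity is claimed only under growth bounds on \<open>k\<close>.\<close>

definition pairing :: "(nat set \<Rightarrow> complex) \<Rightarrow> l2 \<Rightarrow> complex" where
  "pairing k \<xi> = (\<Sum>\<^sub>\<infinity>\<sigma>\<in>finsets. coeff \<xi> \<sigma> * k \<sigma>)"

definition lam_sum :: "real \<Rightarrow> real" where
  "lam_sum r = (\<Sum>\<^sub>\<infinity>\<sigma>\<in>finsets. lam \<sigma> powr (- 2 * r))"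

lemma lam_sum_nonneg: "0 \<le> lam_sum r"
  unfolding lam_sum_def by (intro infsum_nonneg) simp

text \<open>The weight \<lambda>^p is split as \<lambda>^(p-q) times \<lambda>^q. The first factor
  is square summable by \<open>summable_lam\<close>, as q > p + 1/2 means 2(q - p) > 1; the second
  is absorbed into the norm of \<xi>.\<close>

lemma
  assumes q: "q > p + 1 / 2" and \<xi>: "\<xi> \<in> Sp \<theta> q" and M: "0 \<le> M"
    and k: "\<And>\<sigma>. finite \<sigma> \<Longrightarrow> cmod (k \<sigma>) \<le> M * lam \<sigma> powr p"
  shows pairing_summable: "(\<lambda>\<sigma>. coeff \<xi> \<sigma> * k \<sigma>) summable_on finsets"
    and pairing_bound: "cmod (pairing k \<xi>) \<le> M * sqrt (lam_sum (q - p)) * Sp_norm \<theta> q \<xi>"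
proof -
  let ?f = "\<lambda>\<sigma>. lam \<sigma> powr (p - q)" and ?g = "wcoeff q \<xi>"
  have f: "(\<lambda>\<sigma>. (?f \<sigma>)\<^sup>2) = (\<lambda>\<sigma>. lam \<sigma> powr (- 2 * (q - p)))"
    by (simp add: power2_eq_square algebra_simps flip: powr_add)
  have sf: "(\<lambda>\<sigma>. (?f \<sigma>)\<^sup>2) summable_on finsets"
    unfolding f using summable_lam[of "2 * (q - p)"] q by simp
  have sg: "(\<lambda>\<sigma>. (?g \<sigma>)\<^sup>2) summable_on finsets" using \<xi> by (simp add: Sp_iff)
  have fg: "?f \<sigma> * ?g \<sigma> = lam \<sigma> powr p * cmod (coeff \<xi> \<sigma>)" for \<sigma>
    unfolding wcoeff_def mult.assoc[symmetric] by (simp flip: powr_add)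
  have le: "norm (coeff \<xi> \<sigma> * k \<sigma>) \<le> M * \<bar>?f \<sigma> * ?g \<sigma>\<bar>" if "\<sigma> \<in> finsets" for \<sigma>
  proof -
    have "norm (coeff \<xi> \<sigma> * k \<sigma>) \<le> cmod (coeff \<xi> \<sigma>) * (M * lam \<sigma> powr p)"
      using that k by (simp add: norm_mult mult_left_mono)
    then show ?thesis by (simp only: fg) (simp add: abs_mult mult_ac)
  qed
  have sM: "(\<lambda>\<sigma>. M * \<bar>?f \<sigma> * ?g \<sigma>\<bar>) summable_on finsets"
    by (intro summable_on_cmult_right cauchy_schwarz_summable sf sg)
  then have abs: "(\<lambda>\<sigma>. norm (coeff \<xi> \<sigma> * k \<sigma>)) summable_on finsets"
    by (rule Infinite_Sum.abs_summable_on_comparison_test') (rule le)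
  then show "(\<lambda>\<sigma>. coeff \<xi> \<sigma> * k \<sigma>) summable_on finsets"
    by (rule abs_summable_summable)
  have "cmod (pairing k \<xi>) \<le> (\<Sum>\<^sub>\<infinity>\<sigma>\<in>finsets. norm (coeff \<xi> \<sigma> * k \<sigma>))"
    unfolding pairing_def using abs by (rule norm_infsum_bound)
  also have "\<dots> \<le> (\<Sum>\<^sub>\<infinity>\<sigma>\<in>finsets. M * \<bar>?f \<sigma> * ?g \<sigma>\<bar>)"
    by (rule infsum_mono[OF abs sM le])
  also have "\<dots> = M * (\<Sum>\<^sub>\<infinity>\<sigma>\<in>finsets. \<bar>?f \<sigma> * ?g \<sigma>\<bar>)"
    by (rule infsum_cmult_right')
  also have "\<dots> \<le> M * (sqrt (lam_sum (q - p)) * Sp_norm \<theta> q \<xi>)"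
    unfolding lam_sum_def Sp_norm_eq f[symmetric]
    by (intro mult_left_mono cauchy_schwarz_infsum sf sg M)
  finally show "cmod (pairing k \<xi>) \<le> M * sqrt (lam_sum (q - p)) * Sp_norm \<theta> q \<xi>"
    by (simp add: mult_ac)
qed

lemma pairing_lincomb:
  assumes q: "q > p + 1 / 2" and \<xi>: "\<xi> \<in> Sp \<theta> q" and \<eta>: "\<eta> \<in> Sp \<theta> q" and M: "0 \<le> M"
    and k: "\<And>\<sigma>. finite \<sigma> \<Longrightarrow> cmod (k \<sigma>) \<le> M * lam \<sigma> powr p"
  shows "pairing k (l2_lincomb \<theta> a \<xi> b \<eta>) = a * pairing k \<xi> + b * pairing k \<eta>"
proof -
  have "pairing k (l2_lincomb \<theta> a \<xi> b \<eta>)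
      = (\<Sum>\<^sub>\<infinity>\<sigma>\<in>finsets. a * (coeff \<xi> \<sigma> * k \<sigma>) + b * (coeff \<eta> \<sigma> * k \<sigma>))"
    unfolding pairing_def using \<xi> \<eta>
    by (intro infsum_cong) (simp add: coeff_lincomb Sp_in_L2 algebra_simps)
  also have "\<dots> = a * pairing k \<xi> + b * pairing k \<eta>"
    unfolding pairing_def
    using pairing_summable[OF q \<xi> M k] pairing_summable[OF q \<eta> M k]
    by (subst infsum_add) (simp_all add: summable_on_cmult_right infsum_cmult_right')
  finally show ?thesis .
qed

text \<open>Needed for linearity of \<open>kernel_op\<close> in its second argument, which enters
  the outer sum through the kernel. The constants \<open>M\<close> and \<open>N\<close> differ
  because they will depend on the two vectors combined.\<close>

lemma pairing_add_kernel:
  assumes q: "q > p + 1 / 2" and \<xi>: "\<xi> \<in> Sp \<theta> q"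
    and k: "0 \<le> M" "\<And>\<sigma>. finite \<sigma> \<Longrightarrow> cmod (k \<sigma>) \<le> M * lam \<sigma> powr p"
    and l: "0 \<le> N" "\<And>\<sigma>. finite \<sigma> \<Longrightarrow> cmod (l \<sigma>) \<le> N * lam \<sigma> powr p"
  shows "pairing (\<lambda>\<sigma>. a * k \<sigma> + b * l \<sigma>) \<xi> = a * pairing k \<xi> + b * pairing l \<xi>"
proof -
  have "pairing (\<lambda>\<sigma>. a * k \<sigma> + b * l \<sigma>) \<xi>
      = (\<Sum>\<^sub>\<infinity>\<sigma>\<in>finsets. a * (coeff \<xi> \<sigma> * k \<sigma>) + b * (coeff \<xi> \<sigma> * l \<sigma>))"
    unfolding pairing_def by (intro infsum_cong) (simp add: algebra_simps)
  also have "\<dots> = a * pairing k \<xi> + b * pairing l \<xi>"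
    unfolding pairing_def
    using pairing_summable[OF q \<xi> k] pairing_summable[OF q \<xi> l]
    by (subst infsum_add) (simp_all add: summable_on_cmult_right infsum_cmult_right')
  finally show ?thesis .
qed

text \<open>Both abstractions are restricted to the carrier, since \<open>bounded_Sp_ops\<close> and
  \<open>Sp_dual\<close> consist of extensional functions.\<close>

definition kernel_op :: "real \<Rightarrow> (nat set \<Rightarrow> nat set \<Rightarrow> complex) \<Rightarrow> l2 \<Rightarrow> l2 \<Rightarrow> complex" where
  "kernel_op q k = (\<lambda>\<xi>\<in>Sp \<theta> q. \<lambda>\<eta>\<in>Sp \<theta> q. pairing (\<lambda>\<sigma>. pairing (k \<sigma>) \<eta>) \<xi>)"

context
  fixes p q C :: real and k :: "nat set \<Rightarrow> nat set \<Rightarrow> complex"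
  assumes q: "q > p + 1 / 2" and C: "0 \<le> C"
    and k: "\<And>\<sigma> \<tau>. finite \<sigma> \<Longrightarrow> finite \<tau> \<Longrightarrow> cmod (k \<sigma> \<tau>) \<le> C * lam \<sigma> powr p * lam \<tau> powr p"
begin

text \<open>For fixed \<eta> the inner sums form a kernel in \<sigma> that again grows at most like
  \<lambda>^p, so the pairing estimates can be applied a second time.\<close>

lemma inner_pairing_bound:
  assumes "finite \<sigma>" "\<eta> \<in> Sp \<theta> q"
  shows "cmod (pairing (k \<sigma>) \<eta>) \<le> C * sqrt (lam_sum (q - p)) * Sp_norm \<theta> q \<eta> * lam \<sigma> powr p"
  using pairing_bound[OF q assms(2) _ k[OF assms(1)]] C by (simp add: mult_ac)

lemma inner_bound_nonneg: "0 \<le> C * sqrt (lam_sum (q - p)) * Sp_norm \<theta> q \<eta>"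
  using C by (simp add: lam_sum_nonneg Sp_norm_nonneg)

lemma kernel_op_bound:
  assumes \<xi>: "\<xi> \<in> Sp \<theta> q" and \<eta>: "\<eta> \<in> Sp \<theta> q"
  shows "cmod (kernel_op q k \<xi> \<eta>) \<le> C * lam_sum (q - p) * Sp_norm \<theta> q \<xi> * Sp_norm \<theta> q \<eta>"
proof -
  have "cmod (kernel_op q k \<xi> \<eta>)
      \<le> C * sqrt (lam_sum (q - p)) * Sp_norm \<theta> q \<eta> * sqrt (lam_sum (q - p)) * Sp_norm \<theta> q \<xi>"
    using pairing_bound[OF q \<xi> inner_bound_nonneg inner_pairing_bound[OF _ \<eta>]] \<xi> \<eta>
    by (simp add: kernel_op_def)
  \<comment> \<open>Each of the two uses of Cauchy-Schwarz contributed one square root of the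
    sum.\<close>
  also have "\<dots> = C * (sqrt (lam_sum (q - p)) * sqrt (lam_sum (q - p))) * Sp_norm \<theta> q \<xi> * Sp_norm \<theta> q \<eta>"
    by (simp only: mult_ac)
  also have "\<dots> = C * lam_sum (q - p) * Sp_norm \<theta> q \<xi> * Sp_norm \<theta> q \<eta>"
    by (simp add: lam_sum_nonneg)
  finally show ?thesis .
qed

lemma
  assumes \<xi>: "\<xi> \<in> Sp \<theta> q"
  shows kernel_op_in_dual: "kernel_op q k \<xi> \<in> Sp_dual \<theta> q"
    and kernel_op_dual_norm: "Sp_dual_norm \<theta> q (kernel_op q k \<xi>) \<le> C * lam_sum (q - p) * Sp_norm \<theta> q \<xi>"
proof -
  have "kernel_op q k \<xi> \<in> extensional (Sp \<theta> q)"
    using \<xi> by (simp add: kernel_op_def)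
  moreover have "linear_functional (Sp \<theta> q) (kernel_op q k \<xi>)"
    unfolding linear_functional_def
  proof (intro ballI allI)
    fix \<eta> \<zeta> a b assume *: "\<eta> \<in> Sp \<theta> q" "\<zeta> \<in> Sp \<theta> q"
    have "pairing (\<lambda>\<sigma>. pairing (k \<sigma>) (l2_lincomb \<theta> a \<eta> b \<zeta>)) \<xi>
        = pairing (\<lambda>\<sigma>. a * pairing (k \<sigma>) \<eta> + b * pairing (k \<sigma>) \<zeta>) \<xi>"
      unfolding pairing_def[of _ \<xi>]
    proof (rule infsum_cong)
      fix \<sigma> :: "nat set" assume "\<sigma> \<in> finsets"
      then have "pairing (k \<sigma>) (l2_lincomb \<theta> a \<eta> b \<zeta>) = a * pairing (k \<sigma>) \<eta> + b * pairing (k \<sigma>) \<zeta>"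
        \<comment> \<open>At fixed \<sigma> the weight of \<sigma> goes into the constant; linearity
          of the inner sum holds for each \<sigma> separately.\<close>
        using * k C by (intro pairing_lincomb[OF q, of _ _ "C * lam \<sigma> powr p"]) simp_all
      then show "coeff \<xi> \<sigma> * pairing (k \<sigma>) (l2_lincomb \<theta> a \<eta> b \<zeta>)
          = coeff \<xi> \<sigma> * (a * pairing (k \<sigma>) \<eta> + b * pairing (k \<sigma>) \<zeta>)" by simp
    qed
    also have "\<dots> = a * pairing (\<lambda>\<sigma>. pairing (k \<sigma>) \<eta>) \<xi> + b * pairing (\<lambda>\<sigma>. pairing (k \<sigma>) \<zeta>) \<xi>"
      by (rule pairing_add_kernel[OF q \<xi> inner_bound_nonneg inner_pairing_bound[OF _ *(1)]
            inner_bound_nonneg inner_pairing_bound[OF _ *(2)]])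
    finally show "kernel_op q k \<xi> (l2_lincomb \<theta> a \<eta> b \<zeta>) = a * kernel_op q k \<xi> \<eta> + b * kernel_op q k \<xi> \<zeta>"
      using \<xi> * by (simp add: kernel_op_def Sp_lincomb)
  qed
  moreover have "cmod (kernel_op q k \<xi> \<eta>) \<le> C * lam_sum (q - p) * Sp_norm \<theta> q \<xi> * Sp_norm \<theta> q \<eta>"
    if "\<eta> \<in> Sp \<theta> q" for \<eta>
    by (rule kernel_op_bound[OF \<xi> that])
  moreover have "0 \<le> C * lam_sum (q - p) * Sp_norm \<theta> q \<xi>"
    using C by (simp add: lam_sum_nonneg Sp_norm_nonneg)
  ultimately show "kernel_op q k \<xi> \<in> Sp_dual \<theta> q"
    "Sp_dual_norm \<theta> q (kernel_op q k \<xi>) \<le> C * lam_sum (q - p) * Sp_norm \<theta> q \<xi>"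
    by (blast intro: bounded_functional_in_Sp_dual Sp_dual_norm_le)+
qed

lemma kernel_op_in_bounded_ops: "kernel_op q k \<in> bounded_Sp_ops \<theta> q"
proof -
  have "kernel_op q k (l2_lincomb \<theta> a \<xi> b \<eta>) \<zeta> = a * kernel_op q k \<xi> \<zeta> + b * kernel_op q k \<eta> \<zeta>"
    if "\<xi> \<in> Sp \<theta> q" "\<eta> \<in> Sp \<theta> q" "\<zeta> \<in> Sp \<theta> q" for \<xi> \<eta> \<zeta> a b
    using that pairing_lincomb[OF q that(1,2) inner_bound_nonneg inner_pairing_bound[OF _ that(3)]]
    by (simp add: kernel_op_def Sp_lincomb)
  then have "linear_op \<theta> (Sp \<theta> q) (kernel_op q k)"
    by (simp add: linear_op_def)
  moreover have "kernel_op q k \<in> extensional (Sp \<theta> q)"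
    by (simp add: kernel_op_def)
  ultimately show ?thesis
    using kernel_op_in_dual kernel_op_dual_norm by (auto simp: bounded_Sp_ops_def PiE_def)
qed

lemma kernel_op_norm: "Sp_op_norm \<theta> q (kernel_op q k) \<le> C * lam_sum (q - p)"
  unfolding Sp_op_norm_def
proof (rule cSup_least)
  show "{Sp_dual_norm \<theta> q (kernel_op q k \<xi>) | \<xi>. \<xi> \<in> Sp \<theta> q \<and> Sp_norm \<theta> q \<xi> = 1} \<noteq> {}"
    using Z_in_Sp[of "{}"] Sp_norm_Z_empty by blast
  show "x \<le> C * lam_sum (q - p)"
    if "x \<in> {Sp_dual_norm \<theta> q (kernel_op q k \<xi>) | \<xi>. \<xi> \<in> Sp \<theta> q \<and> Sp_norm \<theta> q \<xi> = 1}" for x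
    using that kernel_op_dual_norm by force
qed

end

text \<open>On \<open>S \<theta>\<close> the inner sum is the expansion of the functional
  \<open>T (Z \<theta> \<sigma>)\<close> at \<eta>, and the outer sum is the expansion of
  \<open>T\<close> in its first argument.\<close>

lemma fock_kernel_op_extends:
  assumes T: "continuous_linear_S_op \<theta> T" and q: "0 \<le> q" and \<xi>: "\<xi> \<in> S \<theta>"
  shows "restrict (kernel_op q (fock_transform \<theta> T) \<xi>) (S \<theta>) = T \<xi>"
proof (rule extensionalityI)
  have dual: "T \<zeta> \<in> S_dual \<theta>" if "\<zeta> \<in> S \<theta>" for \<zeta>
    using T that by (auto simp: continuous_linear_S_op_def)
  show "T \<xi> \<in> extensional (S \<theta>)"
    using dual[OF \<xi>] by (simp add: S_dual_def dual_def)
  fix \<eta> assume \<eta>: "\<eta> \<in> S \<theta>"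
  have "pairing (fock_transform \<theta> T \<sigma>) \<eta> = T (Z \<theta> \<sigma>) \<eta>" if "finite \<sigma>" for \<sigma>
    unfolding pairing_def fock_transform_def
    by (rule infsumI[OF S_dual_expansion[OF dual[OF Z_in_S[OF that]] \<eta>]])
  then have "pairing (\<lambda>\<sigma>. pairing (fock_transform \<theta> T \<sigma>) \<eta>) \<xi> = (\<Sum>\<^sub>\<infinity>\<sigma>\<in>finsets. coeff \<xi> \<sigma> * T (Z \<theta> \<sigma>) \<eta>)"
    unfolding pairing_def[of _ \<xi>] by (intro infsum_cong) simp
  also have "\<dots> = T \<xi> \<eta>"
    by (rule infsumI[OF S_op_expansion[OF T \<xi> \<eta>]])
  finally show "restrict (kernel_op q (fock_transform \<theta> T) \<xi>) (S \<theta>) \<eta> = T \<xi> \<eta>"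
    using \<xi> \<eta> q by (simp add: kernel_op_def S_subset_Sp)
qed simp

end

section \<open>Existence and uniqueness of the bounded extension\<close>

theorem theorem3p2:
  fixes \<theta> :: "nat \<Rightarrow> real" and T :: "l2 \<Rightarrow> l2 \<Rightarrow> complex" and C p :: real
  assumes "\<And>n. 0 < \<theta> n" and "\<And>n. \<theta> n < 1"
    and "continuous_linear_S_op \<theta> T"
    and "C \<ge> 0" and "p \<ge> 0"
    and "\<And>\<sigma> \<tau>. finite \<sigma> \<Longrightarrow> finite \<tau> \<Longrightarrow>
      cmod (fock_transform \<theta> T \<sigma> \<tau>) \<le> C * lam \<sigma> powr p * lam \<tau> powr p"
  shows "\<forall>q > p + 1 / 2. \<exists>!T'. T' \<in> bounded_Sp_ops \<theta> q \<and>
      Sp_op_norm \<theta> q T' \<le> C * (\<Sum>\<^sub>\<infinity>\<sigma>\<in>finsets. lam \<sigma> powr (- 2 * (q - p))) \<and>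
      (\<forall>\<xi>\<in>S \<theta>. restrict (T' \<xi>) (S \<theta>) = T \<xi>)"
proof (intro allI impI)
  interpret bernoulli \<theta> by unfold_locales (rule assms)+
  fix q assume q: "q > p + 1 / 2"
  then have q0: "0 \<le> q" using \<open>p \<ge> 0\<close> by simp
  let ?P = "\<lambda>T'. T' \<in> bounded_Sp_ops \<theta> q \<and> Sp_op_norm \<theta> q T' \<le> C * lam_sum (q - p) \<and>
      (\<forall>\<xi>\<in>S \<theta>. restrict (T' \<xi>) (S \<theta>) = T \<xi>)"
  have "\<exists>!T'. ?P T'"
  proof (rule ex_ex1I)
    show "\<exists>T'. ?P T'"
      using kernel_op_in_bounded_ops[OF q assms(4,6)] kernel_op_norm[OF q assms(4,6)]
        fock_kernel_op_extends[OF assms(3) q0] by blast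
    fix U V assume U: "?P U" and V: "?P V"
    show "U = V"
    proof (rule bounded_op_eqI[OF _ _ q0])
      fix \<sigma> \<tau> :: "nat set" assume "finite \<sigma>" "finite \<tau>"
      then have Z: "Z \<theta> \<sigma> \<in> S \<theta>" "Z \<theta> \<tau> \<in> S \<theta>" by (simp_all add: Z_in_S)
      \<comment> \<open>Both restrictions equal \<open>T (Z \<theta> \<sigma>)\<close>, and
        \<open>Z \<theta> \<tau>\<close> lies in \<open>S \<theta>\<close>, so the two extensions
        share their values on all basis pairs.\<close>
      then have "restrict (U (Z \<theta> \<sigma>)) (S \<theta>) = restrict (V (Z \<theta> \<sigma>)) (S \<theta>)"
        using U V by simp
      then show "U (Z \<theta> \<sigma>) (Z \<theta> \<tau>) = V (Z \<theta> \<sigma>) (Z \<theta> \<tau>)"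
        using Z(2) by (metis restrict_apply')
    qed (use U V in blast)+
  qed
  then show "\<exists>!T'. T' \<in> bounded_Sp_ops \<theta> q \<and>
      Sp_op_norm \<theta> q T' \<le> C * (\<Sum>\<^sub>\<infinity>\<sigma>\<in>finsets. lam \<sigma> powr (- 2 * (q - p))) \<and>
      (\<forall>\<xi>\<in>S \<theta>. restrict (T' \<xi>) (S \<theta>) = T \<xi>)"
    by (simp only: lam_sum_def)
qed

end
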